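(* Let $\alpha_1,\alpha_2,\alpha_3,\alpha_4$ be odd integers greater than $1$ and set $$n_1=(\alpha_2-1)(\alpha_3-1)\alpha_4+\alpha_2,\quad n_2=(\alpha_3-1)(\alpha_4-1)\alpha_1+\alpha_3,$$ $$n_3=(\alpha_4-1)(\alpha_1-1)\alpha_2+\alpha_4,\quad n_4=(\alpha_1-1)(\alpha_2-1)\alpha_3+\alpha_1.$$ If $\gcd(n_1,n_2,n_3,n_4)=1$, then $S=\langle n_1,n_2,n_3,n_4\rangle$ is a numerical semigroup of embedding dimension four, generated by odd integers, which is almost symmetric of type three. Moreover, every almost symmetric numerical semigroup of embedding dimension four and type three whose minimal generators are all odd arises in this way (for suitable odd $\alpha_i>1$).
   Context: $\mathrm{PF}(S)$ is the set of integers $f\notin S$ with $f+s\in S$ for all $s\in S\setminus\{0\}$; the type of $S$ is $|\mathrm{PF}(S)|$; $S$ is almost symmetric if $2|\mathbb{N}\setminus S|=F(S)+|\mathrm{PF}(S)|$, where $F(S)=\max(\mathbb{Z}\setminus S)$. The embedding dimension is the number of minimal generators. *)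

theory Defs
  imports Main
begin

inductive_set gen_semigroup :: "nat set \<Rightarrow> nat set" for A :: "nat set" where
  zero: "0 \<in> gen_semigroup A"
| gen: "a \<in> A \<Longrightarrow> a \<in> gen_semigroup A"
| add: "x \<in> gen_semigroup A \<Longrightarrow> y \<in> gen_semigroup A \<Longrightarrow> x + y \<in> gen_semigroup A"

definition numerical_semigroup :: "nat set \<Rightarrow> bool" where
  "numerical_semigroup S \<longleftrightarrow> 0 \<in> S \<and> (\<forall>x\<in>S. \<forall>y\<in>S. x + y \<in> S) \<and> finite (UNIV - S)"

definition minimal_generators :: "nat set \<Rightarrow> nat set" where
  "minimal_generators S = {x \<in> S. x \<noteq> 0 \<and>
      \<not> (\<exists>a\<in>S. \<exists>b\<in>S. a \<noteq> 0 \<and> b \<noteq> 0 \<and> x = a + b)}"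

definition embedding_dim :: "nat set \<Rightarrow> nat" where
  "embedding_dim S = card (minimal_generators S)"

definition gaps :: "nat set \<Rightarrow> nat set" where
  "gaps S = UNIV - S"

(* Frobenius number F(S) = max (Z \ S); equals -1 when S = N *)
definition frobenius :: "nat set \<Rightarrow> int" where
  "frobenius S = (if gaps S = {} then -1 else int (Max (gaps S)))"

definition pseudo_frobenius :: "nat set \<Rightarrow> int set" where
  "pseudo_frobenius S = {f::int. f \<notin> int ` S \<and>
      (\<forall>s\<in>S. s \<noteq> 0 \<longrightarrow> f + int s \<in> int ` S)}"

definition sg_type :: "nat set \<Rightarrow> nat" where
  "sg_type S = card (pseudo_frobenius S)"

definition almost_symmetric :: "nat set \<Rightarrow> bool" where
  "almost_symmetric S \<longleftrightarrow>
     2 * int (card (gaps S)) = frobenius S + int (card (pseudo_frobenius S))"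

definition gens4 :: "nat \<Rightarrow> nat \<Rightarrow> nat \<Rightarrow> nat \<Rightarrow> nat set" where
  "gens4 a1 a2 a3 a4 =
     {(a2 - 1) * (a3 - 1) * a4 + a2,
      (a3 - 1) * (a4 - 1) * a1 + a3,
      (a4 - 1) * (a1 - 1) * a2 + a4,
      (a1 - 1) * (a2 - 1) * a3 + a1}"

end

theory Submission
  imports Defs
begin

text \<open>
  Put \<beta>i = \<alpha>i - 1 and f = \<beta>1 \<beta>2 \<beta>3 \<beta>4 - 1. The generators satisfy the cyclic relations
  f + n1 = \<beta>2 n2, f + n2 = \<beta>3 n3, f + n3 = \<beta>4 n4, f + n4 = \<beta>1 n1. They rewrite every element of S,
  modulo n1, to one of exactly n1 normal forms x n2 + y n3 + z n4; since the gcd is one, the normal forms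
  are the Apery set of n1. Its maximal elements are f + n1, 2f + n1 and 3f + n1, so the pseudo-Frobenius
  numbers are f, 2f, 3f, and the reflection at 3f exchanges the remaining gaps with the elements below 3f.

  Conversely, let S be almost symmetric of type three with odd generators. Its pseudo-Frobenius numbers are
  f, f' and F = f + f' with f odd and f' even, and x or F - x lies in S unless x is f or f'. By
  parity f' - f is not a difference of generators, so for generators i \<noteq> j exactly one of f + i - j and
  f' + j - i lies in S. Thus the digraph of f (an edge from i to j if f + i - j lies in S) determines that of
  f' by reversal and complementation. If i has a single out-neighbour j in one of them, then the
  pseudo-Frobenius number plus i equals (\<alpha> - 1) j, where \<alpha> is the least positive number such that \<alpha> j is
  generated by the other generators; as \<alpha> is odd for f and even for f', all such j are distinct. There are
  twelve edges in total, so only few digraphs remain. Comparing representations, and using that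
  (F + i) / 2 lies in S for every generator i, excludes all of them but the 4-cycle for f. The latter
  means that the cyclic relations hold, and it forces f' = 2f. The normal forms are again pairwise
  incongruent modulo n1, which determines the generators.
\<close>

section \<open>Generated semigroups and minimal generators\<close>

text \<open>The rule \<open>add\<close> joins two arbitrary summands. To add one generator at a
  time, the predicate is strengthened to \<open>P (x + y)\<close> for all \<open>y\<close> in the
  semigroup with \<open>P y\<close>, which is stable under sums.\<close>

lemma gen_semigroup_step_induct [consumes 1, case_names zero step]:
  assumes "x \<in> gen_semigroup A" "P 0" "\<And>a x. a \<in> A \<Longrightarrow> x \<in> gen_semigroup A \<Longrightarrow> P x \<Longrightarrow> P (a + x)"
  shows "P x"
proof -
  have "\<forall>y. y \<in> gen_semigroup A \<and> P y \<longrightarrow> P (x + y)"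
    using assms(1)
  proof induction
    case (add x y)
    then show ?case by (metis add.assoc gen_semigroup.add)
  qed (use assms in auto)
  from this[rule_format, of 0] show ?thesis
    using assms(2) by (simp add: gen_semigroup.zero)
qed

lemma gen_semigroup_subset:
  assumes "0 \<in> S" "\<And>x y. x \<in> S \<Longrightarrow> y \<in> S \<Longrightarrow> x + y \<in> S" "A \<subseteq> S"
  shows "gen_semigroup A \<subseteq> S"
proof
  fix x assume "x \<in> gen_semigroup A"
  then show "x \<in> S" by induction (use assms in auto)
qed

lemma gen_semigroup_split:
  assumes "x \<in> gen_semigroup A" "x \<noteq> 0"
  obtains a y where "a \<in> A" "y \<in> gen_semigroup A" "x = a + y"
proof -
  have "x \<noteq> 0 \<longrightarrow> (\<exists>a\<in>A. \<exists>y\<in>gen_semigroup A. x = a + y)"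
    using assms(1)
  proof (induction rule: gen_semigroup_step_induct)
    case (step a x)
    then show ?case by auto
  qed auto
  then show ?thesis using assms that by blast
qed

lemma minimal_generator_split:
  assumes "numerical_semigroup S" "x \<in> S" "x \<noteq> 0"
  shows "\<exists>m\<in>minimal_generators S. \<exists>y\<in>S. x = m + y"
  using assms(2,3)
proof (induction x rule: less_induct)
  case (less x)
  have S0: "0 \<in> S" and Sadd: "\<And>a b. a \<in> S \<Longrightarrow> b \<in> S \<Longrightarrow> a + b \<in> S"
    using assms(1) by (auto simp: numerical_semigroup_def)
  show ?case
  proof (cases "x \<in> minimal_generators S")
    case True
    then show ?thesis using S0 by force
  next
    case False
    then obtain a b where ab: "a \<in> S" "b \<in> S" "a \<noteq> 0" "b \<noteq> 0" "x = a + b"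
      using less.prems unfolding minimal_generators_def by blast
    then obtain m y where "m \<in> minimal_generators S" "y \<in> S" "a = m + y"
      using less.IH[of a] by auto
    then show ?thesis using ab Sadd by (metis add.assoc)
  qed
qed

lemma gen_semigroup_minimal_generators:
  assumes "numerical_semigroup S"
  shows "gen_semigroup (minimal_generators S) = S"
proof
  show "gen_semigroup (minimal_generators S) \<subseteq> S"
    using assms by (intro gen_semigroup_subset) (auto simp: numerical_semigroup_def minimal_generators_def)
  show "S \<subseteq> gen_semigroup (minimal_generators S)"
  proof
    fix x assume "x \<in> S"
    then show "x \<in> gen_semigroup (minimal_generators S)"
    proof (induction x rule: less_induct)
      case (less x)
      show ?case
      proof (cases "x = 0")
        case False
        then obtain m y where m: "m \<in> minimal_generators S" "y \<in> S" "x = m + y"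
          using minimal_generator_split[OF assms less.prems] by blast
        moreover have "m \<noteq> 0" using m by (auto simp: minimal_generators_def)
        ultimately show ?thesis using less.IH[of y] by (auto intro: gen_semigroup.intros)
      qed (simp add: gen_semigroup.zero)
    qed
  qed
qed

text \<open>If a generator were a sum \<open>u + v\<close> of nonzero elements, splitting a
  generator \<open>b\<close> off \<open>u\<close> would give \<open>a = b + (y + v)\<close>; the
  hypothesis \<open>min\<close> leaves only \<open>b = a\<close>, and then
  \<open>v = 0\<close>.\<close>

lemma minimal_generators_gen_semigroup:
  assumes "0 \<notin> A"
    and min: "\<And>a b x. a \<in> A \<Longrightarrow> b \<in> A \<Longrightarrow> a \<noteq> b \<Longrightarrow> x \<in> gen_semigroup A \<Longrightarrow> a \<noteq> b + x"
  shows "minimal_generators (gen_semigroup A) = A"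
proof
  show "minimal_generators (gen_semigroup A) \<subseteq> A"
  proof
    fix x assume x: "x \<in> minimal_generators (gen_semigroup A)"
    then obtain a y where "a \<in> A" "y \<in> gen_semigroup A" "x = a + y"
      by (auto simp: minimal_generators_def elim: gen_semigroup_split)
    with x assms(1) show "x \<in> A"
      unfolding minimal_generators_def by (metis (mono_tags, lifting) add.right_neutral gen_semigroup.gen mem_Collect_eq)
  qed
  show "A \<subseteq> minimal_generators (gen_semigroup A)"
  proof
    fix a assume a: "a \<in> A"
    have False if uv: "u \<in> gen_semigroup A" "v \<in> gen_semigroup A" "u \<noteq> 0" "v \<noteq> 0" "a = u + v" for u v
    proof -
      obtain b y where b: "b \<in> A" "y \<in> gen_semigroup A" "u = b + y"
        using uv(1,3) by (rule gen_semigroup_split)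
      then have "a = b + (y + v)" using uv by simp
      then show False using min[OF a b(1), of "y + v"] b uv by (auto intro: gen_semigroup.add)
    qed
    moreover have "a \<in> gen_semigroup A" using a by (rule gen_semigroup.gen)
    moreover have "a \<noteq> 0" using a assms(1) by metis
    ultimately show "a \<in> minimal_generators (gen_semigroup A)"
      unfolding minimal_generators_def by blast
  qed
qed

section \<open>Normal forms\<close>

text \<open>A triple (x, y, z) stands for the element x n2 + y n3 + z n4, read modulo n1; the
  parameters are p = \<alpha>2 - 1, q = \<alpha>3 - 1 and r = \<alpha>4 - 1.\<close>

definition normal_forms :: "int \<Rightarrow> int \<Rightarrow> int \<Rightarrow> (int \<times> int \<times> int) set" where
  "normal_forms p q r = {(x, y, z). 0 \<le> x \<and> 0 \<le> y \<and> 0 \<le> z \<and>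
     (x = p \<and> y = 0 \<and> z = 0 \<or> x < p \<and> y < q \<and> z \<le> r \<or> x < p \<and> y = q \<and> z = 0)}"

lemma normal_forms_eq:
  assumes "0 \<le> p" "0 \<le> q" "0 \<le> r"
  shows "normal_forms p q r = {(p, 0, 0)} \<union> ({0..<p} \<times> {0..<q} \<times> {0..r} \<union> {0..<p} \<times> {q} \<times> {0})"
  using assms by (auto simp: normal_forms_def)

lemma finite_normal_forms: "0 \<le> p \<Longrightarrow> 0 \<le> q \<Longrightarrow> 0 \<le> r \<Longrightarrow> finite (normal_forms p q r)"
  by (simp add: normal_forms_eq)

text \<open>For the parameters \<alpha>2 - 1, \<alpha>3 - 1, \<alpha>4 - 1 this number is the
  explicit formula for n1. Both directions of the theorem rest on comparing it with the number of
  residues modulo n1.\<close>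

lemma card_normal_forms:
  assumes "0 \<le> p" "0 \<le> q" "0 \<le> r"
  shows "int (card (normal_forms p q r)) = p * q * (r + 1) + p + 1"
proof -
  have "card ({0..<p} \<times> {0..<q} \<times> {0..r} \<union> {0..<p} \<times> {q} \<times> {0}) =
      card ({0..<p} \<times> {0..<q} \<times> {0..r}) + card ({0..<p} \<times> {q} \<times> {0::int})"
    by (intro card_Un_disjoint) auto
  moreover have "card (normal_forms p q r) =
      1 + card ({0..<p} \<times> {0..<q} \<times> {0..r} \<union> {0..<p} \<times> {q} \<times> {0})"
    unfolding normal_forms_eq[OF assms] by (subst card_Un_disjoint) auto
  ultimately show ?thesis using assms
    by (simp add: card_cartesian_product algebra_simps)
qed

section \<open>Semigroups with a cyclic system of relations\<close>

text \<open>Here \<open>bi\<close> stands for \<alpha>i - 1. The relations are common ground for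
  both directions: for the explicit family they are computed from the formulas, and in the converse
  they come from a four-cycle and the formulas are derived from them.\<close>

locale cyclic_relations =
  fixes b1 b2 b3 b4 n1 n2 n3 n4 f :: int
  assumes b_ge: "2 \<le> b1" "2 \<le> b2" "2 \<le> b3" "2 \<le> b4"
    and n_pos: "0 < n1" "0 < n2" "0 < n3" "0 < n4"
    and f_pos: "0 < f"
    and f_n: "f + n1 = b2 * n2" "f + n2 = b3 * n3" "f + n3 = b4 * n4" "f + n4 = b1 * n1"
begin

lemma rotate: "cyclic_relations b2 b3 b4 b1 n2 n3 n4 n1 f"
  using b_ge n_pos f_pos f_n by unfold_locales auto

definition val :: "int \<times> int \<times> int \<Rightarrow> int" where
  "val w = (case w of (x, y, z) \<Rightarrow> x * n2 + y * n3 + z * n4)"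

lemma val_simp [simp]: "val (x, y, z) = x * n2 + y * n3 + z * n4"
  by (simp add: val_def)

abbreviation W :: "(int \<times> int \<times> int) set" where
  "W \<equiv> normal_forms b2 b3 b4"

lemma finite_W: "finite W"
  using b_ge by (intro finite_normal_forms) auto

text \<open>These triples are the corners of the region of normal forms, where no coordinate can
  grow; subtracting n1 from their values gives the future pseudo-Frobenius numbers.\<close>

lemma top_vals:
  "val (b2, 0, 0) = f + n1"
  "val (b2 - 1, b3, 0) = 2 * f + n1"
  "val (b2 - 1, b3 - 1, b4) = 3 * f + n1"
  using f_n by (simp_all add: algebra_simps)

section \<open>Reduction of combinations of the generators to normal forms\<close>

definition reach :: "int set" where
  "reach = {v. \<exists>w\<in>W. \<exists>k\<ge>0. v = val w + k * n1}"

lemma reachI: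
  assumes "(x, y, z) \<in> W" "0 \<le> k" "v = x * n2 + y * n3 + z * n4 + k * n1"
  shows "v \<in> reach"
  using assms unfolding reach_def by force

lemma reach_add_n1: "v \<in> reach \<Longrightarrow> v + n1 \<in> reach"
proof -
  assume "v \<in> reach"
  then obtain w k where "w \<in> W" "0 \<le> k" "v = val w + k * n1" by (auto simp: reach_def)
  then show ?thesis by (intro reachI[where x = "fst w" and y = "fst (snd w)" and z = "snd (snd w)" and k = "k + 1"]) (auto simp: val_def algebra_simps split: prod.splits)
qed

text \<open>A triple that leaves the region contains some \<open>f + ni\<close>, as a multiple of
  the next generator, and a further summand \<open>nj\<close>. It is rewritten by moving f:
  \<open>(f + ni) + nj = ni + (f + nj)\<close>. The coefficient of n1 never decreases. The same
  mechanism serves for n3 and n4.\<close>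

lemma reach_add_n2:
  assumes "v \<in> reach"
  shows "v + n2 \<in> reach"
proof -
  obtain x y z k where w: "(x, y, z) \<in> W" "0 \<le> k" "v = x * n2 + y * n3 + z * n4 + k * n1"
    using assms by (auto simp: reach_def)
  have "((x + 1, y, z) \<in> W) \<or>
      (x = b2 \<and> y = 0 \<and> z = 0) \<or>
      (x = b2 - 1 \<and> 1 \<le> z \<and> y < b3 \<and> 0 \<le> y \<and> z \<le> b4) \<or>
      (x = b2 - 1 \<and> z = 0 \<and> 1 \<le> y \<and> y \<le> b3)"
    using w(1) unfolding normal_forms_def mem_Collect_eq prod.case by (smt (verit))
  then consider "(x + 1, y, z) \<in> W" | "x = b2" "y = 0" "z = 0"
    | "x = b2 - 1" "1 \<le> z" "y < b3" "0 \<le> y" "z \<le> b4" | "x = b2 - 1" "z = 0" "1 \<le> y" "y \<le> b3"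
    by blast
  then show ?thesis
  proof cases
    case 1
    then show ?thesis by (rule reachI[where k = k]) (use w(2,3) in \<open>simp_all add: algebra_simps\<close>)
  next
    case 2
    show ?thesis
      by (rule reachI[of 0 b3 0 "k + 1"], use 2 b_ge in \<open>simp add: normal_forms_def; linarith\<close>,
        use 2 w(2) b_ge in simp, use f_n in \<open>simp add: 2 w(3) algebra_simps\<close>)
  next
    case 3
    show ?thesis
      by (rule reachI[of 0 y "z - 1" "k + b1 + 1"], use 3 b_ge in \<open>simp add: normal_forms_def; linarith\<close>,
        use 3 w(2) b_ge in simp, use f_n in \<open>simp add: 3 w(3) algebra_simps\<close>)
  next
    case 4
    show ?thesis
      by (rule reachI[of 0 "y - 1" b4 "k + 1"], use 4 b_ge in \<open>simp add: normal_forms_def; linarith\<close>,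
        use 4 w(2) b_ge in simp, use f_n in \<open>simp add: 4 w(3) algebra_simps\<close>)
  qed
qed

lemma reach_add_n3:
  assumes "v \<in> reach"
  shows "v + n3 \<in> reach"
proof -
  obtain x y z k where w: "(x, y, z) \<in> W" "0 \<le> k" "v = x * n2 + y * n3 + z * n4 + k * n1"
    using assms by (auto simp: reach_def)
  have "((x, y + 1, z) \<in> W) \<or>
      (x = b2 \<and> y = 0 \<and> z = 0) \<or>
      (0 \<le> x \<and> x < b2 \<and> y = b3 - 1 \<and> 1 \<le> z \<and> z \<le> b4 \<and> (x + 1 < b2 \<or> z = 1)) \<or>
      (x = b2 - 1 \<and> y = b3 - 1 \<and> 2 \<le> z \<and> z \<le> b4) \<or>
      (0 \<le> x \<and> x + 1 < b2 \<and> y = b3 \<and> z = 0) \<or>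
      (x = b2 - 1 \<and> y = b3 \<and> z = 0)"
    using w(1) unfolding normal_forms_def mem_Collect_eq prod.case by (smt (verit))
  then consider "(x, y + 1, z) \<in> W" | "x = b2" "y = 0" "z = 0"
    | "0 \<le> x" "x < b2" "y = b3 - 1" "1 \<le> z" "z \<le> b4" "x + 1 < b2 \<or> z = 1"
    | "x = b2 - 1" "y = b3 - 1" "2 \<le> z" "z \<le> b4"
    | "0 \<le> x" "x + 1 < b2" "y = b3" "z = 0" | "x = b2 - 1" "y = b3" "z = 0"
    by blast
  then show ?thesis
  proof cases
    case 1
    then show ?thesis by (rule reachI[where k = k]) (use w(2,3) in \<open>simp_all add: algebra_simps\<close>)
  next
    case 2
    show ?thesis
      by (rule reachI[of 0 0 b4 "k + 1"], use 2 b_ge in \<open>simp add: normal_forms_def; linarith\<close>,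
        use 2 w(2) b_ge in simp, use f_n in \<open>simp add: 2 w(3) algebra_simps\<close>)
  next
    case 3
    show ?thesis
      by (rule reachI[of "x + 1" 0 "z - 1" "k + b1"], use 3 b_ge in \<open>simp add: normal_forms_def; linarith\<close>,
        use 3 w(2) b_ge in simp, use f_n in \<open>simp add: 3 w(3) algebra_simps\<close>)
  next
    case 4
    \<comment> \<open>Moving f onto n4 yields \<open>b1\<close> copies of n1 and completes
      \<open>b2 * n2 = f + n1\<close>, whose f moves onto a second n4; this accounts for
      \<open>2 * b1 + 1\<close>.\<close>
    show ?thesis
      by (rule reachI[of 0 0 "z - 2" "k + 2 * b1 + 1"], use 4 b_ge in \<open>simp add: normal_forms_def; linarith\<close>,
        use 4 w(2) b_ge in simp, use f_n in \<open>simp add: 4 w(3) algebra_simps\<close>)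
  next
    case 5
    show ?thesis
      by (rule reachI[of "x + 1" 0 b4 k], use 5 b_ge in \<open>simp add: normal_forms_def; linarith\<close>,
        use 5 w(2) b_ge in simp, use f_n in \<open>simp add: 5 w(3) algebra_simps\<close>)
  next
    case 6
    show ?thesis
      by (rule reachI[of 0 0 "b4 - 1" "k + b1 + 1"], use 6 b_ge in \<open>simp add: normal_forms_def; linarith\<close>,
        use 6 w(2) b_ge in simp, use f_n in \<open>simp add: 6 w(3) algebra_simps\<close>)
  qed
qed

lemma reach_add_n4:
  assumes "v \<in> reach"
  shows "v + n4 \<in> reach"
proof -
  obtain x y z k where w: "(x, y, z) \<in> W" "0 \<le> k" "v = x * n2 + y * n3 + z * n4 + k * n1"
    using assms by (auto simp: reach_def)
  have "((x, y, z + 1) \<in> W) \<or>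
      (x = b2 \<and> y = 0 \<and> z = 0) \<or>
      (0 \<le> x \<and> x < b2 \<and> 0 \<le> y \<and> y < b3 \<and> z = b4) \<or>
      (0 \<le> x \<and> x < b2 \<and> y = b3 \<and> z = 0)"
    using w(1) unfolding normal_forms_def mem_Collect_eq prod.case by (smt (verit))
  then consider "(x, y, z + 1) \<in> W" | "x = b2" "y = 0" "z = 0"
    | "0 \<le> x" "x < b2" "0 \<le> y" "y < b3" "z = b4" | "0 \<le> x" "x < b2" "y = b3" "z = 0"
    by blast
  then show ?thesis
  proof cases
    case 1
    then show ?thesis by (rule reachI[where k = k]) (use w(2,3) in \<open>simp_all add: algebra_simps\<close>)
  next
    case 2
    show ?thesis
      by (rule reachI[of 0 0 0 "k + b1 + 1"], use 2 b_ge in \<open>simp add: normal_forms_def; linarith\<close>,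
        use 2 w(2) b_ge in simp, use f_n in \<open>simp add: 2 w(3) algebra_simps\<close>)
  next
    case 3
    show ?thesis
      by (rule reachI[of x "y + 1" 0 "k + b1"], use 3 b_ge in \<open>simp add: normal_forms_def; linarith\<close>,
        use 3 w(2) b_ge in simp, use f_n in \<open>simp add: 3 w(3) algebra_simps\<close>)
  next
    case 4
    show ?thesis
      by (rule reachI[of "x + 1" 0 0 "k + b1"], use 4 b_ge in \<open>simp add: normal_forms_def; linarith\<close>,
        use 4 w(2) b_ge in simp, use f_n in \<open>simp add: 4 w(3) algebra_simps\<close>)
  qed
qed

lemma zero_reach: "0 \<in> reach"
  by (rule reachI[of 0 0 0 0]) (use b_ge in \<open>auto simp: normal_forms_def\<close>)

lemma combination_reach:
  fixes p q r s :: nat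
  shows "int p * n1 + int q * n2 + int r * n3 + int s * n4 \<in> reach"
proof -
  have add: "v + int p * m \<in> reach" if "v \<in> reach" "\<And>v. v \<in> reach \<Longrightarrow> v + m \<in> reach" for v m p
  proof (induction p)
    case (Suc p)
    from that(2)[OF Suc] show ?case by (simp add: algebra_simps)
  qed (use that in simp)
  show ?thesis
    using add[OF add[OF add[OF add[OF zero_reach reach_add_n1] reach_add_n2] reach_add_n3] reach_add_n4]
    by simp
qed

end

section \<open>The Apery set of n1\<close>

locale cyclic_semigroup = cyclic_relations +
  fixes Z :: "int set"
  assumes Z_eq: "Z = {v. \<exists>p q r s :: nat. v = int p * n1 + int q * n2 + int r * n3 + int s * n4}"
    and n_eq: "n1 = b2 * b3 * (b4 + 1) + b2 + 1" "n2 = b3 * b4 * (b1 + 1) + b3 + 1"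
      "n3 = b4 * b1 * (b2 + 1) + b4 + 1" "n4 = b1 * b2 * (b3 + 1) + b1 + 1"
    and bezout: "\<exists>u1 u2 u3 u4. u1 * n1 + u2 * n2 + u3 * n3 + u4 * n4 = 1"
begin

text \<open>The cyclic symmetry transfers statements about n1 to the other generators.\<close>

lemma rotate_semigroup: "cyclic_semigroup b2 b3 b4 b1 n2 n3 n4 n1 f Z"
proof -
  interpret r: cyclic_relations b2 b3 b4 b1 n2 n3 n4 n1 f by (rule rotate)
  show ?thesis
  proof unfold_locales
    have *: "(\<exists>p q r s. P p q r s) \<longleftrightarrow> (\<exists>q r s p. P p q r s)" for P :: "'x \<Rightarrow> 'x \<Rightarrow> 'x \<Rightarrow> 'x \<Rightarrow> bool"
      by blast
    show "Z = {v. \<exists>p q r s :: nat. v = int p * n2 + int q * n3 + int r * n4 + int s * n1}"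
      unfolding Z_eq by (subst *) (simp add: algebra_simps)
    show "\<exists>u1 u2 u3 u4. u1 * n2 + u2 * n3 + u3 * n4 + u4 * n1 = 1"
      using bezout by (subst (asm) *) (simp add: algebra_simps)
  qed (use n_eq in auto)
qed

lemma Z_comb:
  assumes "0 \<le> p" "0 \<le> q" "0 \<le> r" "0 \<le> s" "v = p * n1 + q * n2 + r * n3 + s * n4"
  shows "v \<in> Z"
  unfolding Z_eq using assms
  by (intro CollectI exI[of _ "nat p"] exI[of _ "nat q"] exI[of _ "nat r"] exI[of _ "nat s"]) simp

lemma Z_reach: "Z \<subseteq> reach"
  unfolding Z_eq using combination_reach by auto

lemma reach_Z: "reach \<subseteq> Z"
proof
  fix v assume "v \<in> reach"
  then obtain x y z k where "(x, y, z) \<in> W" "0 \<le> k" "v = x * n2 + y * n3 + z * n4 + k * n1"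
    by (auto simp: reach_def)
  then show "v \<in> Z" by (intro Z_comb[of k x y z]) (auto simp: normal_forms_def)
qed

text \<open>Modulo n1, Bezout writes \<open>t\<close> as a combination of n2, n3, n4. Reducing its
  coefficients modulo n1 makes them nonnegative, so the combination lies in \<open>Z\<close> and has
  a normal form.\<close>

lemma val_mod_surj: "{0..<n1} \<subseteq> (\<lambda>w. val w mod n1) ` W"
proof
  fix t assume t: "t \<in> {0..<n1}"
  obtain u1 u2 u3 u4 where u: "u1 * n1 + u2 * n2 + u3 * n3 + u4 * n4 = 1"
    using bezout by blast
  define c where "c u = (t * u) mod n1" for u
  have c: "0 \<le> c u" "n1 dvd t * u - c u" for u
    using n_pos by (auto simp: c_def mod_eq_dvd_iff[symmetric])
  define v where "v = c u2 * n2 + c u3 * n3 + c u4 * n4"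
  have "v \<in> reach"
    using Z_reach Z_comb[of 0 "c u2" "c u3" "c u4" v] c by (auto simp: v_def)
  then obtain w k where w: "w \<in> W" "v = val w + k * n1"
    by (auto simp: reach_def)
  have "t - v = t * (u1 * n1 + u2 * n2 + u3 * n3 + u4 * n4) - v"
    using u by simp
  also have "\<dots> = (t * u1) * n1 + (t * u2 - c u2) * n2 + (t * u3 - c u3) * n3 + (t * u4 - c u4) * n4"
    by (simp add: v_def algebra_simps)
  also have "n1 dvd \<dots>" using c(2) by (intro dvd_add dvd_mult2[OF c(2)]) simp
  finally have "t mod n1 = v mod n1" by (simp add: mod_eq_dvd_iff)
  then have "t = val w mod n1" using w t by simp
  then show "t \<in> (\<lambda>w. val w mod n1) ` W" using w by blast
qed

text \<open>All n1 residues are attained, and the domain has just n1 elements.\<close>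

lemma inj_val_mod: "inj_on (\<lambda>w. val w mod n1) W"
proof (rule eq_card_imp_inj_on)
  have "card W = nat n1"
    using card_normal_forms[of b2 b3 b4] b_ge n_eq by simp
  moreover have "nat n1 \<le> card ((\<lambda>w. val w mod n1) ` W)"
    using card_mono[OF _ val_mod_surj] finite_W by simp
  moreover have "card ((\<lambda>w. val w mod n1) ` W) \<le> card W"
    using finite_W by (rule card_image_le)
  ultimately show "card ((\<lambda>w. val w mod n1) ` W) = card W" by simp
qed (rule finite_W)

text \<open>By injectivity \<open>val w\<close> is the least element of \<open>Z\<close> in its
  residue class, so the values on \<open>W\<close> form the Apery set of n1.\<close>

lemma val_mem_iff:
  assumes "w \<in> W"
  shows "val w + k * n1 \<in> Z \<longleftrightarrow> 0 \<le> k"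
proof
  assume "val w + k * n1 \<in> Z"
  then obtain w' k' where w': "w' \<in> W" "0 \<le> k'" "val w + k * n1 = val w' + k' * n1"
    using Z_reach by (auto simp: reach_def)
  then have "val w mod n1 = val w' mod n1"
    by (metis mod_mult_self1)
  then have "w = w'" using inj_val_mod assms w' by (auto dest: inj_onD)
  then show "0 \<le> k" using w' n_pos by auto
next
  assume "0 \<le> k"
  then show "val w + k * n1 \<in> Z" using reach_Z assms by (auto simp: reach_def)
qed

lemma val_minus_notin: "w \<in> W \<Longrightarrow> val w - n1 \<notin> Z"
  using val_mem_iff[of w "-1"] by simp

lemma obtain_val:
  obtains w k where "w \<in> W" "v = val w + k * n1"
proof -
  have "v mod n1 \<in> {0..<n1}" using n_pos by simp
  then obtain w where w: "w \<in> W" "v mod n1 = val w mod n1"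
    using val_mod_surj by blast
  then obtain k where "v - val w = n1 * k"
    by (auto simp: mod_eq_dvd_iff elim: dvdE)
  then show ?thesis using that[of w k] w by (simp add: algebra_simps)
qed

lemma Z_zero: "0 \<in> Z"
  by (rule Z_comb[of 0 0 0 0]) simp_all

lemma Z_n: "n1 \<in> Z" "n2 \<in> Z" "n3 \<in> Z" "n4 \<in> Z"
proof -
  show "n1 \<in> Z" by (rule Z_comb[of 1 0 0 0]) simp_all
  show "n2 \<in> Z" by (rule Z_comb[of 0 1 0 0]) simp_all
  show "n3 \<in> Z" by (rule Z_comb[of 0 0 1 0]) simp_all
  show "n4 \<in> Z" by (rule Z_comb[of 0 0 0 1]) simp_all
qed

lemma Z_nonneg: "v \<in> Z \<Longrightarrow> 0 \<le> v"
  using n_pos by (auto simp: Z_eq)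

lemma Z_add: "u \<in> Z \<Longrightarrow> v \<in> Z \<Longrightarrow> u + v \<in> Z"
proof -
  assume "u \<in> Z" "v \<in> Z"
  then obtain p q r s p' q' r' s' :: nat where
    "u = int p * n1 + int q * n2 + int r * n3 + int s * n4"
    "v = int p' * n1 + int q' * n2 + int r' * n3 + int s' * n4"
    unfolding Z_eq by blast
  then show ?thesis
    by (intro Z_comb[of "int (p + p')" "int (q + q')" "int (r + r')" "int (s + s')"])
      (auto simp: algebra_simps)
qed

text \<open>The unit triples are normal forms. Together with the rotated versions this makes all
  four generators minimal.\<close>

lemma diff_n1_notin: "n2 - n1 \<notin> Z" "n3 - n1 \<notin> Z" "n4 - n1 \<notin> Z"
  using val_minus_notin[of "(1, 0, 0)"] val_minus_notin[of "(0, 1, 0)"] val_minus_notin[of "(0, 0, 1)"] b_ge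
  by (auto simp: normal_forms_def)

section \<open>Pseudo-Frobenius numbers and reflection at 3f\<close>

lemma multiples_f_notin: "f \<notin> Z" "2 * f \<notin> Z" "3 * f \<notin> Z"
  using val_minus_notin[of "(b2, 0, 0)"] val_minus_notin[of "(b2 - 1, b3, 0)"]
    val_minus_notin[of "(b2 - 1, b3 - 1, b4)"] b_ge top_vals
  by (auto simp: normal_forms_def simp del: val_simp)

lemma f_add_n: "f + n1 \<in> Z" "f + n2 \<in> Z" "f + n3 \<in> Z" "f + n4 \<in> Z"
  "2 * f + n1 \<in> Z" "2 * f + n2 \<in> Z" "2 * f + n3 \<in> Z" "2 * f + n4 \<in> Z"
proof -
  show "f + n1 \<in> Z" by (rule Z_comb[of 0 b2 0 0]) (use b_ge f_n in simp_all)
  show "f + n2 \<in> Z" by (rule Z_comb[of 0 0 b3 0]) (use b_ge f_n in simp_all)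
  show "f + n3 \<in> Z" by (rule Z_comb[of 0 0 0 b4]) (use b_ge f_n in simp_all)
  show "f + n4 \<in> Z" by (rule Z_comb[of b1 0 0 0]) (use b_ge f_n in simp_all)
  \<comment> \<open>The first f turns n1 into \<open>b2 * n2\<close>, and the second turns one of
    these n2 into \<open>b3 * n3\<close>; the other lines are rotations.\<close>
  have "2 * f + n1 = 0 * n1 + (b2 - 1) * n2 + b3 * n3 + 0 * n4" "2 * f + n2 = 0 * n1 + 0 * n2 + (b3 - 1) * n3 + b4 * n4"
    "2 * f + n3 = b1 * n1 + 0 * n2 + 0 * n3 + (b4 - 1) * n4" "2 * f + n4 = (b1 - 1) * n1 + b2 * n2 + 0 * n3 + 0 * n4"
    using f_n by (simp_all add: algebra_simps)
  from this[THEN Z_comb[rotated 4]]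
  show "2 * f + n1 \<in> Z" "2 * f + n2 \<in> Z" "2 * f + n3 \<in> Z" "2 * f + n4 \<in> Z"
    using b_ge by simp_all
qed

lemma f3_add_n: "3 * f + n1 \<in> Z" "3 * f + n2 \<in> Z" "3 * f + n3 \<in> Z" "3 * f + n4 \<in> Z"
proof -
  have "3 * f + n1 = 0 * n1 + (b2 - 1) * n2 + (b3 - 1) * n3 + b4 * n4"
    "3 * f + n2 = b1 * n1 + 0 * n2 + (b3 - 1) * n3 + (b4 - 1) * n4"
    "3 * f + n3 = (b1 - 1) * n1 + b2 * n2 + 0 * n3 + (b4 - 1) * n4"
    "3 * f + n4 = (b1 - 1) * n1 + (b2 - 1) * n2 + b3 * n3 + 0 * n4"
    using f_n by (simp_all add: algebra_simps)
  from this[THEN Z_comb[rotated 4]]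
  show "3 * f + n1 \<in> Z" "3 * f + n2 \<in> Z" "3 * f + n3 \<in> Z" "3 * f + n4 \<in> Z"
    using b_ge by simp_all
qed

lemma split_Z:
  assumes "v \<in> Z" "v \<noteq> 0"
  obtains m where "m \<in> {n1, n2, n3, n4}" "v - m \<in> Z"
proof -
  obtain p q r s :: nat where v: "v = int p * n1 + int q * n2 + int r * n3 + int s * n4"
    using assms unfolding Z_eq by blast
  consider "0 < p" | "0 < q" | "0 < r" | "0 < s" using v assms by fastforce
  then show ?thesis
  proof cases
    case 1
    then show ?thesis using v
      by (intro that[of n1] Z_comb[of "int p - 1" "int q" "int r" "int s"]) (auto simp: algebra_simps)
  next
    case 2
    then show ?thesis using v
      by (intro that[of n2] Z_comb[of "int p" "int q - 1" "int r" "int s"]) (auto simp: algebra_simps)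
  next
    case 3
    then show ?thesis using v
      by (intro that[of n3] Z_comb[of "int p" "int q" "int r - 1" "int s"]) (auto simp: algebra_simps)
  next
    case 4
    then show ?thesis using v
      by (intro that[of n4] Z_comb[of "int p" "int q" "int r" "int s - 1"]) (auto simp: algebra_simps)
  qed
qed

text \<open>A pseudo-Frobenius number is a maximal Apery element minus n1, and the maximal normal
  forms are the three corners.\<close>

lemma pseudo_frobenius_eq:
  "{g. g \<notin> Z \<and> (\<forall>s\<in>Z. s \<noteq> 0 \<longrightarrow> g + s \<in> Z)} = {f, 2 * f, 3 * f}" (is "?PF = _")
proof
  show "{f, 2 * f, 3 * f} \<subseteq> ?PF"
  proof -
    have "g + s \<in> Z" if s: "s \<in> Z" "s \<noteq> 0" and g: "g \<in> {f, 2 * f, 3 * f}" for g s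
    proof -
      obtain m where m: "m \<in> {n1, n2, n3, n4}" "s - m \<in> Z"
        using s by (rule split_Z)
      then have "g + m \<in> Z" using g f_add_n f3_add_n by (elim insertE emptyE) simp_all
      from Z_add[OF this m(2)] show ?thesis by simp
    qed
    then show ?thesis using multiples_f_notin by blast
  qed
  show "?PF \<subseteq> {f, 2 * f, 3 * f}"
  proof
    fix g assume "g \<in> ?PF"
    then have g: "g \<notin> Z" "\<And>s. s \<in> Z \<Longrightarrow> s \<noteq> 0 \<Longrightarrow> g + s \<in> Z" by auto
    obtain w k where w: "w \<in> W" "g = val w + k * n1" by (rule obtain_val)
    have "g + n1 \<in> Z" using g(2)[OF Z_n(1)] n_pos by simp
    then have "0 \<le> k + 1" using val_mem_iff[OF w(1), of "k + 1"] w by (simp add: algebra_simps)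
    moreover have "\<not> 0 \<le> k" using val_mem_iff[OF w(1)] w g by simp
    ultimately have "k = - 1" by simp
    then have gw: "g = val w - n1" using w by simp
    obtain x y z where xyz: "w = (x, y, z)" by (cases w)
    have gn: "g + n2 \<in> Z" "g + n3 \<in> Z" "g + n4 \<in> Z"
      using g(2)[OF Z_n(2)] g(2)[OF Z_n(3)] g(2)[OF Z_n(4)] n_pos by simp_all
    have "val (x + 1, y, z) - n1 = g + n2" "val (x, y + 1, z) - n1 = g + n3"
      "val (x, y, z + 1) - n1 = g + n4"
      unfolding gw xyz by (simp_all add: algebra_simps)
    \<comment> \<open>If a neighbouring triple were a normal form, its value minus n1, which is
      \<open>g\<close> plus a generator, would lie outside \<open>Z\<close>.\<close>
    then have no: "(x + 1, y, z) \<notin> W" "(x, y + 1, z) \<notin> W" "(x, y, z + 1) \<notin> W"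
      using val_minus_notin gn by metis+
    have W_iff: "(x, y, z) \<in> W \<longleftrightarrow> 0 \<le> x \<and> 0 \<le> y \<and> 0 \<le> z \<and>
       (x = b2 \<and> y = 0 \<and> z = 0 \<or> x < b2 \<and> y < b3 \<and> z \<le> b4 \<or> x < b2 \<and> y = b3 \<and> z = 0)" for x y z
      by (simp add: normal_forms_def)
    have "(x, y, z) \<in> W" using w(1) xyz by simp
    then consider "x = b2" "y = 0" "z = 0" | "0 \<le> x" "0 \<le> y" "0 \<le> z" "x < b2" "y < b3" "z \<le> b4"
      | "0 \<le> x" "x < b2" "y = b3" "z = 0"
      unfolding W_iff by blast
    then have "(x, y, z) = (b2, 0, 0) \<or> (x, y, z) = (b2 - 1, b3, 0) \<or> (x, y, z) = (b2 - 1, b3 - 1, b4)"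
    proof cases
      case 2
      then show ?thesis using no b_ge unfolding W_iff by auto
    next
      case 3
      then show ?thesis using no(1) b_ge unfolding W_iff by auto
    qed simp
    then have "w = (b2, 0, 0) \<or> w = (b2 - 1, b3, 0) \<or> w = (b2 - 1, b3 - 1, b4)"
      unfolding xyz .
    then have "val w = f + n1 \<or> val w = 2 * f + n1 \<or> val w = 3 * f + n1"
      using top_vals by metis
    then show "g \<in> {f, 2 * f, 3 * f}" unfolding gw by auto
  qed
qed

text \<open>The box in \<open>W\<close> is symmetric under complement in the corner of value
  \<open>3 * f + n1\<close>, and the strip \<open>y = b3\<close>, \<open>x \<le> b2 - 2\<close> is
  symmetric under complement in x. At the two remaining corners v differs from f and 2f by a
  multiple of n1, and the hypotheses exclude \<open>k = -1\<close>.\<close>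

lemma reflect:
  assumes "v \<notin> Z" "v \<noteq> f" "v \<noteq> 2 * f"
  shows "3 * f - v \<in> Z"
proof -
  obtain x y z k where w: "(x, y, z) \<in> W" "v = val (x, y, z) + k * n1" using obtain_val by (metis prod_cases3)
  then have k: "k < 0" using val_mem_iff assms by force
  have "0 \<le> x" "0 \<le> y" "0 \<le> z" using w by (auto simp: normal_forms_def)
  have "(x = b2 \<and> y = 0 \<and> z = 0) \<or>
      (x < b2 \<and> y < b3 \<and> z \<le> b4) \<or>
      (x = b2 - 1 \<and> y = b3 \<and> z = 0) \<or>
      (x \<le> b2 - 2 \<and> y = b3 \<and> z = 0)"
    using w(1) unfolding normal_forms_def mem_Collect_eq prod.case by (smt (verit))
  then consider "x = b2" "y = 0" "z = 0" | "x < b2" "y < b3" "z \<le> b4"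
    | "x = b2 - 1" "y = b3" "z = 0" | "x \<le> b2 - 2" "y = b3" "z = 0"
    by blast
  then show ?thesis
  proof cases
    case 1
    then have v: "v = f + (k + 1) * n1" using f_n by (simp add: w(2) algebra_simps)
    then have "k \<noteq> -1" using assms by auto
    moreover have "3 * f - v = (- k - 2) * n1 + (b2 - 1) * n2 + b3 * n3 + 0 * n4"
      using f_n by (simp add: v algebra_simps)
    ultimately show ?thesis using k b_ge by (intro Z_comb[of "- k - 2" "b2 - 1" b3 0]) auto
  next
    case 2
    have "3 * f - v = (- k - 1) * n1 + (b2 - 1 - x) * n2 + (b3 - 1 - y) * n3 + (b4 - z) * n4"
      using f_n by (simp add: w(2) algebra_simps)
    with 2 k show ?thesis
      by (intro Z_comb[of "- k - 1" "b2 - 1 - x" "b3 - 1 - y" "b4 - z"]) auto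
  next
    case 3
    have v: "v = 2 * f + (k + 1) * n1" using f_n by (simp add: 3 w(2) algebra_simps)
    then have "k \<noteq> -1" using assms by auto
    moreover have "3 * f - v = (- k - 2) * n1 + b2 * n2 + 0 * n3 + 0 * n4"
      using f_n by (simp add: v algebra_simps)
    ultimately show ?thesis using k b_ge by (intro Z_comb[of "- k - 2" b2 0 0]) auto
  next
    case 4
    have "3 * f - v = (- k - 1) * n1 + (b2 - 2 - x) * n2 + b3 * n3 + 0 * n4"
      using f_n by (simp add: w(2) 4(2,3) algebra_simps)
    with 4 k b_ge show ?thesis
      by (intro Z_comb[of "- k - 1" "b2 - 2 - x" b3 0]) auto
  qed
qed

end

section \<open>Reflection at the Frobenius number\<close>

context
  fixes S :: "nat set"
  assumes S: "numerical_semigroup S" and gaps_ne: "gaps S \<noteq> {}"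
begin

lemma finite_gaps: "finite (gaps S)"
  using S by (simp add: numerical_semigroup_def gaps_def)

lemma int_image_add: "x \<in> int ` S \<Longrightarrow> y \<in> int ` S \<Longrightarrow> x + y \<in> int ` S"
  using S by (force simp: numerical_semigroup_def)

lemma frobenius_eq: "frobenius S = int (Max (gaps S))"
  using gaps_ne by (simp add: frobenius_def)

lemma frobenius_notin: "frobenius S \<notin> int ` S"
  using Max_in[OF finite_gaps gaps_ne] by (auto simp: frobenius_eq gaps_def)

lemma frobenius_nonneg: "0 \<le> frobenius S"
  by (simp add: frobenius_eq)

lemma gt_frobenius:
  assumes "frobenius S < x"
  shows "x \<in> int ` S"
proof -
  have "nat x \<notin> gaps S" using Max_ge[OF finite_gaps, of "nat x"] assms
    by (auto simp: frobenius_eq)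
  then have "nat x \<in> S" by (simp add: gaps_def)
  then show ?thesis using assms frobenius_nonneg by (intro image_eqI[of _ _ "nat x"]) auto
qed

lemma reflect_notin: "x \<in> int ` S \<Longrightarrow> frobenius S - x \<notin> int ` S"
  using int_image_add[of x "frobenius S - x"] frobenius_notin by auto

text \<open>Reflection embeds the elements of S in [0, F] into the gaps, and the numbers counted
  here are the gaps left over. Almost symmetry says that their number is the type minus one.\<close>

lemma card_unreflected:
  "int (card {x. x \<notin> int ` S \<and> frobenius S - x \<notin> int ` S}) = 2 * int (card (gaps S)) - frobenius S - 1"
proof -
  define F where "F = frobenius S"
  define Z where "Z = int ` S"
  note F = frobenius_notin frobenius_nonneg gt_frobenius reflect_notin
  have neg: "x \<notin> Z" if "x < 0" for x using that by (auto simp: Z_def)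
  have G: "int ` gaps S = {0..F} - Z"
  proof
    show "int ` gaps S \<subseteq> {0..F} - Z"
      using Max_ge[OF finite_gaps] by (auto simp: F_def Z_def frobenius_eq gaps_def)
    show "{0..F} - Z \<subseteq> int ` gaps S"
    proof
      fix x assume "x \<in> {0..F} - Z"
      then have "x = int (nat x)" "nat x \<in> gaps S" by (auto simp: Z_def gaps_def image_iff)
      then show "x \<in> int ` gaps S" by blast
    qed
  qed
  have cG: "card (gaps S) = card ({0..F} - Z)"
    unfolding G[symmetric] by (simp add: card_image)
  have cZ: "card {0..F} = card ({0..F} \<inter> Z) + card ({0..F} - Z)"
    using card_Int_Diff[of "{0..F}" Z] by simp
  have "{x. x \<notin> Z \<and> F - x \<notin> Z} = ({0..F} - Z) - (\<lambda>x. F - x) ` ({0..F} \<inter> Z)" (is "?L = ?R")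
  proof
    show "?L \<subseteq> ?R"
    proof
      fix x assume x: "x \<in> ?L"
      then have "\<not> F < x" "\<not> F < F - x" using F(3) by (auto simp: F_def Z_def)
      then show "x \<in> ?R" using x by auto
    qed
    show "?R \<subseteq> ?L"
    proof
      fix x assume x: "x \<in> ?R"
      have "F - x \<notin> Z"
      proof
        assume "F - x \<in> Z"
        then have "x \<in> (\<lambda>x. F - x) ` ({0..F} \<inter> Z)" using x by (intro image_eqI[of _ _ "F - x"]) auto
        then show False using x by blast
      qed
      then show "x \<in> ?L" using x by blast
    qed
  qed
  moreover have "(\<lambda>x. F - x) ` ({0..F} \<inter> Z) \<subseteq> {0..F} - Z"
    using F(4) by (auto simp: F_def Z_def)
  moreover have "card ((\<lambda>x. F - x) ` ({0..F} \<inter> Z)) = card ({0..F} \<inter> Z)"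
    by (intro card_image) (auto simp: inj_on_def)
  ultimately have "card ?L = card ({0..F} - Z) - card ({0..F} \<inter> Z)"
    "card ({0..F} \<inter> Z) \<le> card ({0..F} - Z)"
    by (simp_all add: card_Diff_subset) (metis card_mono finite_Diff finite_atLeastAtMost_int)
  then have "int (card ?L) = 2 * int (card (gaps S)) - int (card {0..F})"
    using cG cZ by simp
  also have "\<dots> = 2 * int (card (gaps S)) - F - 1"
    using F(2) by (simp add: F_def)
  finally show ?thesis by (simp add: F_def Z_def)
qed

lemma pseudo_frobenius_alt:
  "pseudo_frobenius S = {f. f \<notin> int ` S \<and> (\<forall>s\<in>int ` S. s \<noteq> 0 \<longrightarrow> f + s \<in> int ` S)}"
  by (auto simp: pseudo_frobenius_def)

lemma frobenius_pseudo: "frobenius S \<in> pseudo_frobenius S"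
  unfolding pseudo_frobenius_alt using frobenius_notin gt_frobenius by auto

text \<open>The pseudo-Frobenius numbers other than F are all unreflected, and almost symmetry gives
  both sets two elements, so they agree. Reflection exchanges the two: it has no fixed point because
  \<open>2 * card (gaps S) = F + 3\<close> makes F odd.\<close>

lemma type_three_pseudo_frobenius:
  assumes "sg_type S = 3" "almost_symmetric S"
  obtains f f' where "odd f" "even f'" "f + f' = frobenius S"
    "f \<in> pseudo_frobenius S" "f' \<in> pseudo_frobenius S"
    "\<And>x. x \<notin> int ` S \<Longrightarrow> x \<noteq> f \<Longrightarrow> x \<noteq> f' \<Longrightarrow> f + f' - x \<in> int ` S"
proof -
  define F where "F = frobenius S"
  define L where "L = {x. x \<notin> int ` S \<and> F - x \<notin> int ` S}"
  have PF3: "card (pseudo_frobenius S) = 3" using assms by (simp add: sg_type_def)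
  then have g: "2 * int (card (gaps S)) = F + 3"
    using assms by (simp add: almost_symmetric_def F_def)
  have L2: "card L = 2"
    using card_unreflected g by (simp add: L_def F_def)
  then have "finite L" by (auto intro: card_ge_0_finite)
  have sub: "pseudo_frobenius S - {F} \<subseteq> L"
  proof
    fix x assume x: "x \<in> pseudo_frobenius S - {F}"
    then have pf: "\<And>s. s \<in> int ` S \<Longrightarrow> s \<noteq> 0 \<Longrightarrow> x + s \<in> int ` S" and "x \<noteq> F"
      unfolding pseudo_frobenius_alt by blast+
    \<comment> \<open>Otherwise \<open>F - x\<close> would be a nonzero element of S, and
      \<open>x + (F - x) = F\<close> would lie in S.\<close>
    have "F - x \<notin> int ` S"
      using pf[of "F - x"] frobenius_notin \<open>x \<noteq> F\<close> by (auto simp: F_def)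
    then show "x \<in> L" using x unfolding L_def pseudo_frobenius_alt by blast
  qed
  have "card (pseudo_frobenius S - {F}) = 2"
    using PF3 frobenius_pseudo by (simp add: F_def)
  then have Leq: "pseudo_frobenius S - {F} = L"
    using sub L2 \<open>finite L\<close> by (intro card_subset_eq) auto
  obtain a b where ab: "L = {a, b}" "a \<noteq> b" using L2 by (auto simp: card_2_iff)
  have refl: "x \<in> L \<Longrightarrow> F - x \<in> L" for x by (auto simp: L_def)
  have "odd F" using g by presburger
  then have "F - a \<noteq> a" by presburger
  then have sum: "a + b = F" using refl[of a] ab by auto
  have ex: "F - x \<in> int ` S" if "x \<notin> int ` S" "x \<noteq> a" "x \<noteq> b" for x
    using that ab by (auto simp: L_def)
  have pf: "a \<in> pseudo_frobenius S" "b \<in> pseudo_frobenius S" using Leq ab by auto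
  show ?thesis
  proof (cases "odd a")
    case True
    then have "even b" using sum \<open>odd F\<close> by auto
    then show ?thesis using that[of a b] True sum pf ex by (simp add: F_def)
  next
    case False
    then have "odd b" using sum \<open>odd F\<close> by auto
    then show ?thesis using that[of b a] False sum pf ex by (simp add: F_def add.commute)
  qed
qed

end

section \<open>The explicit family\<close>

lemma gens4_semigroup_int:
  fixes n1 n2 n3 n4 :: nat
  shows "int ` gen_semigroup {n1, n2, n3, n4} =
    {v. \<exists>p q r s :: nat. v = int p * int n1 + int q * int n2 + int r * int n3 + int s * int n4}" (is "?L = ?R")
proof
  show "?L \<subseteq> ?R"
  proof
    fix v assume "v \<in> ?L"
    then obtain x where x: "x \<in> gen_semigroup {n1, n2, n3, n4}" "v = int x" by blast
    from x(1) have "\<exists>p q r s. x = p * n1 + q * n2 + r * n3 + s * n4"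
    proof (induction rule: gen_semigroup_step_induct)
      case (step a x)
      then obtain p q r s where x: "x = p * n1 + q * n2 + r * n3 + s * n4" by blast
      have "a + x = Suc p * n1 + q * n2 + r * n3 + s * n4 \<or> a + x = p * n1 + Suc q * n2 + r * n3 + s * n4
        \<or> a + x = p * n1 + q * n2 + Suc r * n3 + s * n4 \<or> a + x = p * n1 + q * n2 + r * n3 + Suc s * n4"
        using step(1) x by auto
      then show ?case by blast
    qed auto
    then show "v \<in> ?R" using x(2) by (auto simp flip: of_nat_mult of_nat_add)
  qed
  show "?R \<subseteq> ?L"
  proof
    fix v assume "v \<in> ?R"
    then obtain p q r s :: nat where v: "v = int (p * n1 + q * n2 + r * n3 + s * n4)" by auto
    have mult: "p * n \<in> gen_semigroup {n1, n2, n3, n4}" if "n \<in> {n1, n2, n3, n4}" for p n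
      using that by (induction p) (auto intro: gen_semigroup.intros)
    show "v \<in> ?L" unfolding v by (intro imageI gen_semigroup.add mult) auto
  qed
qed

lemma bezout_four:
  fixes n1 n2 n3 n4 :: nat
  assumes "Gcd {n1, n2, n3, n4} = 1"
  shows "\<exists>u1 u2 u3 u4. u1 * int n1 + u2 * int n2 + u3 * int n3 + u4 * int n4 = 1"
proof -
  obtain p q where pq: "p * int n3 + q * int n4 = gcd (int n3) (int n4)"
    using bezout_int by blast
  obtain t c where tc: "t * int n2 + c * gcd (int n3) (int n4) = gcd (int n2) (gcd (int n3) (int n4))"
    using bezout_int by blast
  obtain a d where ad: "a * int n1 + d * gcd (int n2) (gcd (int n3) (int n4)) =
      gcd (int n1) (gcd (int n2) (gcd (int n3) (int n4)))"
    using bezout_int by blast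
  have "gcd n1 (gcd n2 (gcd n3 n4)) = 1" using assms by simp
  then have "gcd (int n1) (gcd (int n2) (gcd (int n3) (int n4))) = 1"
    by (metis gcd_int_int_eq of_nat_1)
  then have "a * int n1 + (d * t) * int n2 + (d * c * p) * int n3 + (d * c * q) * int n4 = 1"
    using ad tc pq by (metis (no_types, lifting) add.assoc distrib_left mult.assoc)
  then show ?thesis by blast
qed

theorem explicit_family_almost_symmetric:
  fixes a1 a2 a3 a4 :: nat
  assumes a: "1 < a1" "1 < a2" "1 < a3" "1 < a4" "odd a1" "odd a2" "odd a3" "odd a4"
    and gcd: "Gcd (gens4 a1 a2 a3 a4) = 1"
  defines "S \<equiv> gen_semigroup (gens4 a1 a2 a3 a4)"
  shows "numerical_semigroup S" "embedding_dim S = 4" "almost_symmetric S" "sg_type S = 3"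
proof -
  define m1 m2 m3 m4 where "m1 = (a2 - 1) * (a3 - 1) * a4 + a2" "m2 = (a3 - 1) * (a4 - 1) * a1 + a3"
    "m3 = (a4 - 1) * (a1 - 1) * a2 + a4" "m4 = (a1 - 1) * (a2 - 1) * a3 + a1"
  define b1 b2 b3 b4 where "b1 = int a1 - 1" "b2 = int a2 - 1" "b3 = int a3 - 1" "b4 = int a4 - 1"
  define f where "f = b1 * b2 * b3 * b4 - 1"
  have gens: "gens4 a1 a2 a3 a4 = {m1, m2, m3, m4}" by (simp add: gens4_def m1_m2_m3_m4_def)
  have b: "2 \<le> b1" "2 \<le> b2" "2 \<le> b3" "2 \<le> b4"
    using a by (auto simp: b1_b2_b3_b4_def) presburger+
  have m: "int m1 = b2 * b3 * (b4 + 1) + b2 + 1" "int m2 = b3 * b4 * (b1 + 1) + b3 + 1"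
      "int m3 = b4 * b1 * (b2 + 1) + b4 + 1" "int m4 = b1 * b2 * (b3 + 1) + b1 + 1"
    using a by (auto simp: m1_m2_m3_m4_def b1_b2_b3_b4_def of_nat_diff)
  have "4 \<le> b1 * b2" "4 \<le> b3 * b4" using b mult_mono[of 2 _ 2] by fastforce+
  then have fpos: "0 < f" using mult_mono[of 4 "b1 * b2" 4 "b3 * b4"] b by (simp add: f_def mult.assoc)
  define Z where "Z = int ` S"
  have Zeq: "Z = {v. \<exists>p q r s :: nat. v = int p * int m1 + int q * int m2 + int r * int m3 + int s * int m4}"
    unfolding Z_def S_def gens by (rule gens4_semigroup_int)
  interpret cyclic_semigroup b1 b2 b3 b4 "int m1" "int m2" "int m3" "int m4" f Z
  proof unfold_locales
    show "\<exists>u1 u2 u3 u4. u1 * int m1 + u2 * int m2 + u3 * int m3 + u4 * int m4 = 1"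
      using gcd unfolding gens by (rule bezout_four)
    show "f + int m1 = b2 * int m2" "f + int m2 = b3 * int m3" "f + int m3 = b4 * int m4" "f + int m4 = b1 * int m1"
      unfolding m f_def by (simp_all add: algebra_simps)
    show "0 < int m1" "0 < int m2" "0 < int m3" "0 < int m4"
      unfolding m using b by (auto intro!: add_nonneg_pos mult_nonneg_nonneg)
  qed (use b fpos Zeq m in auto)
  interpret r2: cyclic_semigroup b2 b3 b4 b1 "int m2" "int m3" "int m4" "int m1" f Z by (rule rotate_semigroup)
  interpret r3: cyclic_semigroup b3 b4 b1 b2 "int m3" "int m4" "int m1" "int m2" f Z by (rule r2.rotate_semigroup)
  interpret r4: cyclic_semigroup b4 b1 b2 b3 "int m4" "int m1" "int m2" "int m3" f Z by (rule r3.rotate_semigroup)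
  have mem: "x \<in> S \<longleftrightarrow> int x \<in> Z" for x by (auto simp: Z_def)
  \<comment> \<open>Reflection sends a gap beyond 3f to a negative number; hence the complement is
    finite and 3f is the Frobenius number.\<close>
  have big: "v \<in> Z" if "3 * f < v" for v
  proof (rule ccontr)
    assume "v \<notin> Z"
    then have "3 * f - v \<in> Z" using reflect that fpos by simp
    then show False using Z_nonneg that by force
  qed
  have "UNIV - S \<subseteq> {..nat (3 * f)}"
    using big by (force simp: mem)
  then have "finite (UNIV - S)" by (rule finite_subset) simp
  then show S: "numerical_semigroup S"
    unfolding numerical_semigroup_def by (auto simp: S_def intro: gen_semigroup.intros)
  have gap: "nat (3 * f) \<in> gaps S" using multiples_f_notin fpos by (simp add: gaps_def mem)
  then have ne: "gaps S \<noteq> {}" by blast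
  have "Max (gaps S) = nat (3 * f)"
  proof (rule Max_eqI[OF finite_gaps[OF S ne] _ gap])
    fix y assume "y \<in> gaps S"
    then have "int y \<notin> Z" by (simp add: gaps_def mem)
    then show "y \<le> nat (3 * f)" using big[of "int y"] by linarith
  qed
  then have F: "frobenius S = 3 * f" using fpos by (simp add: frobenius_eq[OF S ne])
  have PF: "pseudo_frobenius S = {f, 2 * f, 3 * f}"
    unfolding pseudo_frobenius_alt[OF S ne] using pseudo_frobenius_eq by (simp add: Z_def)
  then show type: "sg_type S = 3" using fpos by (simp add: sg_type_def)
  \<comment> \<open>There are two unreflected numbers, one less than the type, which is almost
    symmetry.\<close>
  have "{x. x \<notin> int ` S \<and> frobenius S - x \<notin> int ` S} = {f, 2 * f}"
  proof -
    have "2 * f = 3 * f - f" "f = 3 * f - 2 * f" by simp_all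
    then show ?thesis using reflect multiples_f_notin unfolding F Z_def[symmetric] by auto
  qed
  then have "int (card {f, 2 * f}) = 2 * int (card (gaps S)) - frobenius S - 1"
    using card_unreflected[OF S ne] by simp
  then show "almost_symmetric S"
    using fpos type by (simp add: almost_symmetric_def sg_type_def)
  have dist: "x \<noteq> y + z" if "x \<in> {m1, m2, m3, m4}" "y \<in> {m1, m2, m3, m4}" "x \<noteq> y" "z \<in> S" for x y z
  proof
    assume "x = y + z"
    then have "int x - int y \<in> Z" using that mem by simp
    then show False
      using that(1-3) diff_n1_notin r2.diff_n1_notin r3.diff_n1_notin r4.diff_n1_notin by auto
  qed
  have "minimal_generators S = {m1, m2, m3, m4}"
    unfolding S_def gens
  proof (rule minimal_generators_gen_semigroup)
    show "0 \<notin> {m1, m2, m3, m4}" using n_pos by auto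
  qed (use dist[unfolded S_def gens] in blast)
  moreover have "distinct [m1, m2, m3, m4]"
    using diff_n1_notin r2.diff_n1_notin r3.diff_n1_notin Z_zero by auto
  ultimately show "embedding_dim S = 4" by (simp add: embedding_dim_def)
qed

lemma odd_gens4:
  assumes "odd a1" "odd a2" "odd a3" "odd a4" "x \<in> gens4 a1 a2 a3 a4"
  shows "odd x"
  using assms by (auto simp: gens4_def)

section \<open>Divisibility graphs of the pseudo-Frobenius numbers\<close>

locale generated_semigroup =
  fixes Z M :: "int set"
  assumes Z_zero: "0 \<in> Z"
    and Z_add: "\<And>x y. x \<in> Z \<Longrightarrow> y \<in> Z \<Longrightarrow> x + y \<in> Z"
    and Z_nonneg: "\<And>x. x \<in> Z \<Longrightarrow> 0 \<le> x"
    and M_Z: "\<And>m. m \<in> M \<Longrightarrow> m \<in> Z"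
    and M_pos: "\<And>m. m \<in> M \<Longrightarrow> 0 < m"
    and M_odd: "\<And>m. m \<in> M \<Longrightarrow> odd m"
    and Z_split: "\<And>x. x \<in> Z \<Longrightarrow> x \<noteq> 0 \<Longrightarrow> \<exists>m\<in>M. x - m \<in> Z"
    and M_minimal: "\<And>m k. m \<in> M \<Longrightarrow> k \<in> M \<Longrightarrow> m \<noteq> k \<Longrightarrow> m - k \<notin> Z"
begin

text \<open>In the digraph of \<open>g\<close>, with an edge from \<open>i\<close> to
  \<open>j\<close> if \<open>g + i - j\<close> lies in \<open>Z\<close>, the vertex \<open>i\<close>
  has no out-neighbour other than \<open>j\<close>. That \<open>j\<close> is one is derived in
  \<open>single_edge\<close>.\<close>

definition single :: "int \<Rightarrow> int \<Rightarrow> int \<Rightarrow> bool" where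
  "single g i j \<longleftrightarrow> i \<in> M \<and> j \<in> M \<and> i \<noteq> j \<and> (\<forall>k\<in>M. k \<noteq> j \<longrightarrow> g + i - k \<notin> Z)"

definition quadruple :: "int \<Rightarrow> int \<Rightarrow> int \<Rightarrow> int \<Rightarrow> bool" where
  "quadruple a b c d \<longleftrightarrow> M = {a, b, c, d} \<and> distinct [a, b, c, d]"

lemma quadruple_mem:
  assumes "quadruple a b c d"
  shows "a \<in> M" "b \<in> M" "c \<in> M" "d \<in> M" "a \<noteq> b" "a \<noteq> c" "a \<noteq> d" "b \<noteq> c" "b \<noteq> d" "c \<noteq> d"
    "b \<noteq> a" "c \<noteq> a" "d \<noteq> a" "c \<noteq> b" "d \<noteq> b" "d \<noteq> c"
  using assms by (auto simp: quadruple_def)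

lemma quadruple_perm:
  assumes "quadruple a b c d" "{w, x, y, z} = {a, b, c, d}" "distinct [w, x, y, z]"
  shows "quadruple w x y z"
  using assms unfolding quadruple_def by simp

lemma quadruple_rotate:
  assumes "quadruple a b c d"
  shows "quadruple b c d a"
proof (rule quadruple_perm[OF assms])
  show "{b, c, d, a} = {a, b, c, d}" by blast
  show "distinct [b, c, d, a]" using quadruple_mem[OF assms] by simp
qed

lemma Z_mult:
  assumes "x \<in> Z" "0 \<le> c"
  shows "c * x \<in> Z"
proof -
  have "int n * x \<in> Z" for n
    by (induction n) (use assms Z_zero Z_add in \<open>auto simp: algebra_simps\<close>)
  from this[of "nat c"] show ?thesis using assms by simp
qed

lemma Z_comb2: "k \<in> M \<Longrightarrow> l \<in> M \<Longrightarrow> 0 \<le> p \<Longrightarrow> 0 \<le> q \<Longrightarrow> p * k + q * l \<in> Z"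
  by (intro Z_add Z_mult M_Z)

lemma Z_comb3: "k \<in> M \<Longrightarrow> l \<in> M \<Longrightarrow> m \<in> M \<Longrightarrow> 0 \<le> p \<Longrightarrow> 0 \<le> q \<Longrightarrow> 0 \<le> r \<Longrightarrow> p * k + q * l + r * m \<in> Z"
  by (intro Z_add Z_mult M_Z)

lemma minus_notin_mono:
  assumes "x - k \<notin> Z" "m \<in> M"
  shows "(x - m) - k \<notin> Z"
proof
  assume "x - m - k \<in> Z"
  from Z_add[OF this M_Z[OF assms(2)]] show False using assms by (simp add: algebra_simps)
qed

text \<open>Peeling off generators one by one keeps track of which ones can be subtracted from x: a
  generator that cannot be subtracted has coefficient zero. This is how two- and three-term
  representations are obtained.\<close>

lemma representation:
  assumes M: "quadruple a b c d" and x: "x \<in> Z"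
  shows "\<exists>p q r s. 0 \<le> p \<and> 0 \<le> q \<and> 0 \<le> r \<and> 0 \<le> s \<and> x = p * a + q * b + r * c + s * d \<and>
     (p = 0 \<or> x - a \<in> Z) \<and> (q = 0 \<or> x - b \<in> Z) \<and> (r = 0 \<or> x - c \<in> Z) \<and> (s = 0 \<or> x - d \<in> Z)"
  using x
proof (induction "nat x" arbitrary: x rule: less_induct)
  case less
  show ?case
  proof (cases "x = 0")
    case True
    then show ?thesis by (intro exI[of _ 0]) simp
  next
    case False
    then obtain m where m: "m \<in> M" "x - m \<in> Z" using Z_split less.prems by blast
    have "nat (x - m) < nat x" using M_pos[OF m(1)] Z_nonneg[OF m(2)] by simp
    from less.hyps[OF this m(2)] obtain p q r s where
      pqrs: "0 \<le> p" "0 \<le> q" "0 \<le> r" "0 \<le> s" "x - m = p * a + q * b + r * c + s * d"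
      and div: "p = 0 \<or> x - m - a \<in> Z" "q = 0 \<or> x - m - b \<in> Z" "r = 0 \<or> x - m - c \<in> Z" "s = 0 \<or> x - m - d \<in> Z"
      by blast
    have div': "p = 0 \<or> x - a \<in> Z" "q = 0 \<or> x - b \<in> Z" "r = 0 \<or> x - c \<in> Z" "s = 0 \<or> x - d \<in> Z"
      using div minus_notin_mono[OF _ m(1)] by blast+
    have "m = a \<or> m = b \<or> m = c \<or> m = d" using m(1) M by (auto simp: quadruple_def)
    then show ?thesis
    proof (elim disjE)
      assume "m = a"
      then have "x = (p + 1) * a + q * b + r * c + s * d" "x - a \<in> Z" using pqrs(5) m(2) by (simp_all add: algebra_simps)
      with pqrs(1-4) div' show ?thesis
        by (intro exI[of _ "p + 1"] exI[of _ q] exI[of _ r] exI[of _ s] conjI) simp_all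
    next
      assume "m = b"
      then have "x = p * a + (q + 1) * b + r * c + s * d" "x - b \<in> Z" using pqrs(5) m(2) by (simp_all add: algebra_simps)
      with pqrs(1-4) div' show ?thesis
        by (intro exI[of _ p] exI[of _ "q + 1"] exI[of _ r] exI[of _ s] conjI) simp_all
    next
      assume "m = c"
      then have "x = p * a + q * b + (r + 1) * c + s * d" "x - c \<in> Z" using pqrs(5) m(2) by (simp_all add: algebra_simps)
      with pqrs(1-4) div' show ?thesis
        by (intro exI[of _ p] exI[of _ q] exI[of _ "r + 1"] exI[of _ s] conjI) simp_all
    next
      assume "m = d"
      then have "x = p * a + q * b + r * c + (s + 1) * d" "x - d \<in> Z" using pqrs(5) m(2) by (simp_all add: algebra_simps)
      with pqrs(1-4) div' show ?thesis
        by (intro exI[of _ p] exI[of _ q] exI[of _ r] exI[of _ "s + 1"] conjI) simp_all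
    qed
  qed
qed

lemma representation3:
  assumes "quadruple a b c d" "x \<in> Z" "x - a \<notin> Z"
  obtains q r s where "0 \<le> q" "0 \<le> r" "0 \<le> s" "x = q * b + r * c + s * d"
proof -
  obtain p q r s where *: "0 \<le> q" "0 \<le> r" "0 \<le> s" "x = p * a + q * b + r * c + s * d" "p = 0 \<or> x - a \<in> Z"
    using representation[OF assms(1,2)] by blast
  then show ?thesis using assms(3) that[of q r s] by simp
qed

lemma representation2:
  assumes "quadruple a b c d" "x \<in> Z" "x - a \<notin> Z" "x - b \<notin> Z"
  obtains r s where "0 \<le> r" "0 \<le> s" "x = r * c + s * d"
proof -
  obtain p q r s where *: "0 \<le> r" "0 \<le> s" "x = p * a + q * b + r * c + s * d"
    "p = 0 \<or> x - a \<in> Z" "q = 0 \<or> x - b \<in> Z"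
    using representation[OF assms(1,2)] by blast
  then show ?thesis using assms(3,4) that[of r s] by simp
qed

lemma only_multiple:
  assumes "x \<in> Z" "j \<in> M" "\<forall>k\<in>M. k \<noteq> j \<longrightarrow> x - k \<notin> Z"
  shows "\<exists>c\<ge>0. x = c * j"
  using assms(1,3)
proof (induction "nat x" arbitrary: x rule: less_induct)
  case less
  show ?case
  proof (cases "x = 0")
    case False
    then obtain m where m: "m \<in> M" "x - m \<in> Z" using Z_split less.prems by blast
    then have "m = j" using less.prems by blast
    have "nat (x - m) < nat x" using M_pos[OF m(1)] Z_nonneg[OF m(2)] by simp
    moreover have "\<forall>k\<in>M. k \<noteq> j \<longrightarrow> (x - m) - k \<notin> Z"
      using less.prems(2) minus_notin_mono[OF _ m(1)] by blast
    ultimately obtain c where "0 \<le> c" "x - m = c * j" using less.hyps m(2) by blast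
    then show ?thesis using \<open>m = j\<close> by (intro exI[of _ "c + 1"]) (auto simp: algebra_simps)
  qed (auto intro: exI[of _ 0])
qed

text \<open>Adding \<open>(c - m) * j\<close> would carry \<open>m * j - k\<close> to
  \<open>g + i - k\<close>. So multiples of \<open>j\<close> up to \<open>c\<close> have only
  trivial representations by other generators, the main means of excluding digraphs below.\<close>

lemma single_unique:
  assumes "single g i j" "g + i = c * j" "m \<le> c" "k \<in> M" "k \<noteq> j"
  shows "m * j - k \<notin> Z"
proof
  assume mk: "m * j - k \<in> Z"
  have "j \<in> M" using assms(1) by (simp add: single_def)
  then have "(c - m) * j \<in> Z" using assms(3) by (intro Z_mult M_Z) auto
  from Z_add[OF mk this] have "(m * j - k) + (c - m) * j \<in> Z" .
  then have "g + i - k \<in> Z" using assms(2) by (simp add: algebra_simps)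
  then show False using assms by (auto simp: single_def)
qed

lemma single_unique2:
  assumes "single g i j" "g + i = c * j" "m \<le> c" "k \<in> M" "k \<noteq> j" "l \<in> M" "l \<noteq> j"
    "0 \<le> p" "0 \<le> q" "m * j = p * k + q * l"
  shows "p = 0 \<and> q = 0 \<and> m = 0"
proof -
  have j: "0 < j" using assms(1) M_pos by (auto simp: single_def)
  have "p = 0"
  proof (rule ccontr)
    assume "p \<noteq> 0"
    then have "(p - 1) * k + q * l \<in> Z" using assms by (intro Z_comb2) auto
    then have "m * j - k \<in> Z" using assms(10) by (simp add: algebra_simps)
    then show False using single_unique[OF assms(1-5)] by simp
  qed
  moreover have "q = 0"
  proof (rule ccontr)
    assume "q \<noteq> 0"
    then have "p * k + (q - 1) * l \<in> Z" using assms by (intro Z_comb2) auto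
    then have "m * j - l \<in> Z" using assms(10) by (simp add: algebra_simps)
    then show False using single_unique[OF assms(1-3,6,7)] by simp
  qed
  ultimately show ?thesis using assms(10) j by simp
qed

lemma single_unique1:
  assumes "single g i j" "g + i = c * j" "m \<le> c" "k \<in> M" "k \<noteq> j" "0 < p" "m * j = p * k"
  shows False
  using single_unique2[OF assms(1-5) assms(4,5), of p 0] assms(6,7) by simp

end

section \<open>The digraphs of two pseudo-Frobenius numbers exchanged by reflection\<close>

locale reflected_semigroup = generated_semigroup +
  fixes f f' :: int
  assumes f_notin: "f \<notin> Z" "f' \<notin> Z" "f + f' \<notin> Z"
    and f_add: "\<And>z. z \<in> Z \<Longrightarrow> z \<noteq> 0 \<Longrightarrow> f + z \<in> Z" "\<And>z. z \<in> Z \<Longrightarrow> z \<noteq> 0 \<Longrightarrow> f' + z \<in> Z"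
    and reflect: "\<And>x. x \<notin> Z \<Longrightarrow> x \<noteq> f \<Longrightarrow> x \<noteq> f' \<Longrightarrow> f + f' - x \<in> Z"
    and odd_sum: "odd (f + f')"
begin

lemma swap: "reflected_semigroup Z M f' f"
proof unfold_locales
  show "odd (f' + f)" using odd_sum by (simp add: add.commute)
  show "f' + f \<notin> Z" using f_notin by (simp add: add.commute)
  show "f' + f - x \<in> Z" if "x \<notin> Z" "x \<noteq> f'" "x \<noteq> f" for x
    using reflect[of x] that by (simp add: add.commute)
qed (use f_notin f_add in auto)

lemma f_add_M: "m \<in> M \<Longrightarrow> f + m \<in> Z" "m \<in> M \<Longrightarrow> f' + m \<in> Z"
  using f_add M_Z M_pos by force+

lemma diff_notin: "f' - f \<notin> Z" "f - f' \<notin> Z"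
proof -
  have "f \<noteq> f'" using odd_sum by auto
  then show "f' - f \<notin> Z" "f - f' \<notin> Z"
    using f_add(1)[of "f' - f"] f_add(2)[of "f - f'"] f_notin by auto
qed

text \<open>The two numbers add up to \<open>f + f'\<close>, so not both lie in \<open>Z\<close>.
  Reflection exchanges them; the exception f would mean \<open>i = j\<close>, and f' is impossible
  by parity, as \<open>i - j\<close> is even and \<open>f + f'\<close> is odd.\<close>

lemma edge_iff:
  assumes "i \<in> M" "j \<in> M" "i \<noteq> j"
  shows "f' + j - i \<in> Z \<longleftrightarrow> f + i - j \<notin> Z"
proof
  assume "f' + j - i \<in> Z"
  then show "f + i - j \<notin> Z" using Z_add[of "f' + j - i" "f + i - j"] f_notin by (auto simp: add.commute)
next
  assume "f + i - j \<notin> Z"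
  moreover have "f + i - j \<noteq> f'" using odd_sum M_odd[OF assms(1)] M_odd[OF assms(2)] by auto
  ultimately have "f + f' - (f + i - j) \<in> Z" using assms by (intro reflect) auto
  then show "f' + j - i \<in> Z" by (simp add: algebra_simps)
qed

text \<open>If \<open>h\<close> were outside \<open>Z\<close>, reflection would put
  \<open>f + f' - h = h - i\<close> into \<open>Z\<close>, and adding \<open>i\<close> would give
  \<open>h\<close>. The exception \<open>h = f\<close> would mean \<open>f = f' + i\<close>, an
  element of \<open>Z\<close>; likewise for f'.\<close>

lemma half:
  assumes "i \<in> M"
  obtains h where "h \<in> Z" "2 * h = f + f' + i"
proof -
  have "even (f + f' + i)" using odd_sum M_odd[OF assms] by simp
  then obtain h where h: "f + f' + i = 2 * h" by (rule evenE)
  have "h \<in> Z"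
  proof (rule ccontr)
    assume h': "h \<notin> Z"
    have "h \<noteq> f" "h \<noteq> f'" using h f_add_M[OF assms] f_notin by auto
    then have "f + f' - h \<in> Z" using reflect h' by blast
    moreover have "f + f' - h = h - i" using h by simp
    ultimately have "h - i \<in> Z" by simp
    then show False using Z_add[OF _ M_Z[OF assms]] h' by force
  qed
  then show ?thesis using that h by simp
qed

text \<open>Only \<open>j\<close> can be peeled off \<open>f + i\<close>. The case
  \<open>c = 0\<close> would make \<open>f + j = j - i\<close> an element of \<open>Z\<close>,
  against minimality, and the parity holds because generators are odd.\<close>

lemma single_multiple:
  assumes "single f i j"
  obtains c where "1 \<le> c" "f + i = c * j" "even c \<longleftrightarrow> odd f"
proof -
  have ij: "i \<in> M" "j \<in> M" "i \<noteq> j" using assms by (auto simp: single_def)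
  obtain c where c: "0 \<le> c" "f + i = c * j"
    using only_multiple[of "f + i" j] assms f_add_M[OF ij(1)] by (auto simp: single_def)
  have "c \<noteq> 0"
  proof
    assume "c = 0"
    then have "f + j = j - i" using c by simp
    then show False using f_add_M[OF ij(2)] M_minimal ij by metis
  qed
  moreover have "even c \<longleftrightarrow> odd f"
    using arg_cong[OF c(2), of even] M_odd[OF ij(1)] M_odd[OF ij(2)] by simp
  ultimately show ?thesis using that[of c] c by simp
qed

lemma single_edge: "single f i j \<Longrightarrow> f + i - j \<in> Z"
proof -
  assume s: "single f i j"
  obtain c where c: "1 \<le> c" "f + i = c * j" by (rule single_multiple[OF s])
  have "(c - 1) * j \<in> Z" using s c by (intro Z_mult M_Z) (auto simp: single_def)
  then show ?thesis using c by (simp add: algebra_simps)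
qed

lemma single_coedge:
  assumes "single f i j"
  shows "f' + j - i \<notin> Z" "k \<in> M \<Longrightarrow> k \<noteq> i \<Longrightarrow> k \<noteq> j \<Longrightarrow> f' + k - i \<in> Z"
  using assms single_edge[OF assms] edge_iff by (auto simp: single_def)

text \<open>With a common target, \<open>i - k\<close> is a multiple of \<open>j\<close>, so it or
  its negative lies in \<open>Z\<close>, against minimality.\<close>

lemma single_inj:
  assumes s: "single f i j" "single f k j"
  shows "i = k"
proof (rule ccontr)
  assume "i \<noteq> k"
  obtain c where c: "f + i = c * j" by (rule single_multiple[OF s(1)])
  obtain c' where c': "f + k = c' * j" by (rule single_multiple[OF s(2)])
  have M: "i \<in> M" "k \<in> M" "j \<in> M" using s by (auto simp: single_def)
  have eq: "i - k = (c - c') * j" "k - i = (c' - c) * j" using c c' by (simp_all add: algebra_simps)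
  have "i - k \<in> Z \<or> k - i \<in> Z"
    unfolding eq using Z_mult[OF M_Z[OF M(3)], of "c - c'"] Z_mult[OF M_Z[OF M(3)], of "c' - c"] by linarith
  then show False using M M_minimal \<open>i \<noteq> k\<close> by metis
qed

text \<open>If \<open>c < c'\<close>, then only \<open>j\<close> could be subtracted from
  \<open>(c + 1) * j\<close>, yet \<open>(c + 1) * j - i = f + j\<close> lies in
  \<open>Z\<close>.\<close>

lemma single_targets_disjoint_aux:
  assumes s: "single f i j" "single f' k j" and c: "f + i = c * j" "f' + k = c' * j"
  shows "c' \<le> c"
proof (rule ccontr)
  assume "\<not> c' \<le> c"
  then have "(c + 1) * j - i \<notin> Z"
    using s c by (intro single_unique[OF s(2) c(2)]) (auto simp: single_def)
  moreover have "(c + 1) * j - i = f + j" using c by (simp add: algebra_simps)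
  ultimately show False using s f_add_M by (auto simp: single_def)
qed

text \<open>By symmetry \<open>c = c'\<close>, but their parities differ because those of f and f'
  do.\<close>

lemma single_targets_disjoint:
  assumes s: "single f i j" "single f' k j"
  shows False
proof -
  interpret r: reflected_semigroup Z M f' f by (rule swap)
  obtain c where c: "f + i = c * j" "even c \<longleftrightarrow> odd f" by (rule single_multiple[OF s(1)])
  obtain c' where c': "f' + k = c' * j" "even c' \<longleftrightarrow> odd f'" by (rule r.single_multiple[OF s(2)])
  have "c = c'"
    using single_targets_disjoint_aux[OF s c(1) c'(1)] r.single_targets_disjoint_aux[OF s(2,1) c'(1) c(1)] by simp
  then show False using c c' odd_sum by auto
qed

lemma out_edge:
  assumes M: "quadruple a b c d"
  shows "f + a - b \<in> Z \<or> f + a - c \<in> Z \<or> f + a - d \<in> Z"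
proof -
  note q = quadruple_mem[OF M]
  have "f + a \<noteq> 0"
  proof
    assume "f + a = 0"
    then have "f + b = b - a" by simp
    then show False using f_add_M(1)[OF q(2)] M_minimal[OF q(2,1)] q by simp
  qed
  then obtain m where "m \<in> M" "f + a - m \<in> Z" using Z_split f_add_M(1)[OF q(1)] by blast
  moreover have "f + a - a \<notin> Z" using f_notin by simp
  ultimately show ?thesis using M by (auto simp: quadruple_def)
qed

end

section \<open>Vertices with a single out-neighbour in both digraphs\<close>

context reflected_semigroup
begin

text \<open>Writing \<open>f' + b\<close> by \<open>c\<close> and \<open>d\<close> and eliminating f
  and f', uniqueness forces \<open>u = m\<close>, \<open>v = t - 1\<close> and \<open>p = 1\<close>.
  For odd f this contradicts even \<open>p\<close>. For even f, halving \<open>f + f' + a\<close>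
  gives a relation between \<open>c\<close> and \<open>d\<close> that is nontrivial because
  \<open>m\<close> is odd, against uniqueness for \<open>c\<close> or for \<open>d\<close>.\<close>

lemma no_vertex_single_in_both:
  assumes M: "quadruple a b c d" and s1: "single f a b" and s2: "single f' a d" and s3: "single f d c"
  shows False
proof -
  interpret r: reflected_semigroup Z M f' f by (rule swap)
  note q = quadruple_mem[OF M]
  obtain p where p: "1 \<le> p" "f + a = p * b" "even p \<longleftrightarrow> odd f" by (rule single_multiple[OF s1])
  obtain t where t: "1 \<le> t" "f' + a = t * d" "even t \<longleftrightarrow> odd f'" by (rule r.single_multiple[OF s2])
  obtain m where m: "1 \<le> m" "f + d = m * c" "even m \<longleftrightarrow> odd f" by (rule single_multiple[OF s3])
  have ba: "f' + b - a \<notin> Z" by (rule single_coedge(1)[OF s1])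
  have "f' + b - b \<notin> Z" using f_notin by simp
  then obtain u v where uv: "0 \<le> u" "0 \<le> v" "f' + b = u * c + v * d"
    by (rule representation2[OF M f_add_M(2)[OF q(2)] ba])
  have "v \<le> t - 1"
  proof (rule ccontr)
    assume "\<not> v \<le> t - 1"
    then have "u * c + (v - t) * d \<in> Z" using uv(1,2) by (intro Z_comb2 q) auto
    moreover have "u * c + (v - t) * d = b - a" using uv(3) t(2) by (simp add: algebra_simps)
    ultimately show False using M_minimal[OF q(2,1,11)] by simp
  qed
  moreover have "u \<le> m"
  proof (rule ccontr)
    assume "\<not> u \<le> m"
    then have "(u - m - 1) * c + (v + 1) * d \<in> Z" using uv(1,2) by (intro Z_comb2 q) auto
    \<comment> \<open>For f' the only out-neighbour of \<open>a\<close> is \<open>d\<close>; so the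
      edge from \<open>a\<close> to \<open>c\<close> is missing there, and the edge from
      \<open>c\<close> to \<open>a\<close> is present for f.\<close>
    moreover have "f + c - a \<in> Z" using q by (intro r.single_coedge(2)[OF s2])
    ultimately have "(u - m - 1) * c + (v + 1) * d + (f + c - a) \<in> Z" by (rule Z_add)
    moreover have "(u - m - 1) * c + (v + 1) * d + (f + c - a) = f' + b - a"
      using uv(3) m(2) by (simp add: algebra_simps)
    ultimately show False using ba by simp
  qed
  moreover have "(p - 1) * b = (m - u) * c + (t - 1 - v) * d"
    using p(2) t(2) m(2) uv(3) by (simp add: algebra_simps)
  ultimately have eq: "m - u = 0 \<and> t - 1 - v = 0 \<and> p - 1 = 0"
    by (intro single_unique2[OF s1 p(2) _ q(3,14) q(4,15)]) simp_all
  show False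
  proof (cases "odd f")
    case True
    then show False using p eq by auto
  next
    case False
    then have par: "odd m" "even t" using m t odd_sum by auto
    obtain h where h: "h \<in> Z" "2 * h = f + f' + a" by (rule half[OF q(1)])
    have "u = m" "v = t - 1" "p = 1" using eq by simp_all
    then have h2: "2 * h = m * c + (t - 1) * d" using h(2) p(2) uv(3) by simp
    have ha: "h - a \<notin> Z"
    proof
      assume "h - a \<in> Z"
      from Z_add[OF h(1) this] have "h + (h - a) \<in> Z" .
      moreover have "h + (h - a) = f + f'" using h(2) by simp
      ultimately show False using f_notin by simp
    qed
    have hb: "h - b \<notin> Z"
    proof
      assume "h - b \<in> Z"
      from Z_add[OF h(1) this] have "h + (h - b) \<in> Z" .
      moreover have "h + (h - b) = f'" using h(2) p(2) \<open>p = 1\<close> by simp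
      ultimately show False using f_notin by simp
    qed
    obtain y z where yz: "0 \<le> y" "0 \<le> z" "h = y * c + z * d"
      by (rule representation2[OF M h(1) ha hb])
    have rel: "(2 * y - m) * c = (t - 1 - 2 * z) * d"
      using h2 unfolding yz(3) by (simp add: algebra_simps)
    have "2 * y \<noteq> m" using par by auto
    then consider "m < 2 * y" | "2 * y < m" by linarith
    then show False
    proof cases
      case 1
      then have "t - 1 - 2 * z \<le> t" "0 < 2 * y - m" using yz by simp_all
      then show False by (rule single_unique1[OF s2 t(2) _ q(3,10) _ rel[symmetric]])
    next
      case 2
      then have "0 < (m - 2 * y) * c" using M_pos q by simp
      then have "0 < (2 * z - t + 1) * d" using rel by (simp add: algebra_simps)
      then have "0 < 2 * z - t + 1" using M_pos[OF q(4)] by (simp add: zero_less_mult_iff)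
      moreover have "(m - 2 * y) * c = (2 * z - t + 1) * d" using rel by (simp add: algebra_simps)
      moreover have "m - 2 * y \<le> m" using yz by simp
      ultimately show False by (intro single_unique1[OF s3 m(2) _ q(4,16)])
    qed
  qed
qed

subsection \<open>Cycles of length two\<close>

text \<open>Both \<open>(q + 1) * a\<close> and \<open>(p + 1) * b\<close> equal
  \<open>f + a + b\<close>. Dividing by a common factor above 1 leaves at most \<open>q\<close>
  copies of \<open>a\<close> equal to a multiple of \<open>b\<close>, against uniqueness.\<close>

lemma two_cycle_coprime:
  assumes s: "single f a b" "single f b a" and pq: "1 \<le> p" "1 \<le> q" "f + a = p * b" "f + b = q * a"
  shows "coprime (p + 1) (q + 1)"
proof -
  have ab: "a \<in> M" "b \<in> M" "a \<noteq> b" using s by (auto simp: single_def)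
  define e where "e = gcd (p + 1) (q + 1)"
  have e: "0 < e" using pq by (simp add: e_def)
  have "e dvd p + 1" "e dvd q + 1" by (simp_all add: e_def)
  then obtain p' q' where p': "p + 1 = e * p'" and q': "q + 1 = e * q'" by (elim dvdE)
  have "0 < e * p'" "0 < e * q'" using pq by (simp_all flip: p' q')
  then have pos: "0 < p'" "0 < q'" using e by (simp_all add: zero_less_mult_iff)
  have "e * (q' * a) = (q + 1) * a" "e * (p' * b) = (p + 1) * b" by (simp_all add: p' q')
  then have "e * (q' * a) = e * (p' * b)" using pq by (simp add: algebra_simps)
  then have rel: "q' * a = p' * b" using e by simp
  have "e = 1"
  proof (rule ccontr)
    assume "e \<noteq> 1"
    then have "2 * q' \<le> e * q'" using e pos by simp
    then have "q' \<le> q" using q' pos by linarith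
    then show False using single_unique1[OF s(2) pq(4) _ ab(2) _ pos(1) rel] ab by simp
  qed
  then show ?thesis by (simp add: e_def coprime_iff_gcd_eq_1)
qed

text \<open>For even f both \<open>p\<close> and \<open>q\<close> are odd, so \<open>p + 1\<close>
  and \<open>q + 1\<close> share the factor 2.\<close>

lemma no_two_cycle_even:
  assumes s: "single f a b" "single f b a" and "even f"
  shows False
proof -
  obtain p where p: "1 \<le> p" "f + a = p * b" "even p \<longleftrightarrow> odd f" by (rule single_multiple[OF s(1)])
  obtain q where q: "1 \<le> q" "f + b = q * a" "even q \<longleftrightarrow> odd f" by (rule single_multiple[OF s(2)])
  have "coprime (p + 1) (q + 1)" using two_cycle_coprime[OF s] p q by simp
  moreover have "2 dvd p + 1" "2 dvd q + 1" using p q assms by auto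
  ultimately have "is_unit (2 :: int)" by (rule coprime_common_divisor)
  then show False by simp
qed

text \<open>Two generators a = (p + 1) g and b = (q + 1) g span g times a symmetric semigroup with
  Frobenius number f / g, so every multiple of g in the semigroup is already spanned by a and b.\<close>

lemma two_cycle_multiples:
  assumes s: "single f a b" "single f b a"
  obtains g where "0 < g" "g dvd a" "g dvd b" "g dvd f"
    "\<forall>z\<in>Z. g dvd z \<longrightarrow> (\<exists>x y. 0 \<le> x \<and> 0 \<le> y \<and> z = x * a + y * b)"
proof -
  obtain p where p: "1 \<le> p" "f + a = p * b" "even p \<longleftrightarrow> odd f" by (rule single_multiple[OF s(1)])
  obtain q where q: "1 \<le> q" "f + b = q * a" "even q \<longleftrightarrow> odd f" by (rule single_multiple[OF s(2)])
  have ab: "a \<in> M" "b \<in> M" using s by (auto simp: single_def)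
  have cop: "coprime (p + 1) (q + 1)" using two_cycle_coprime[OF s] p q by simp
  have rel: "(q + 1) * a = (p + 1) * b" using p q by (simp add: algebra_simps)
  then have "p + 1 dvd a" using cop by (metis coprime_dvd_mult_right_iff dvd_triv_left)
  then obtain g where a: "a = (p + 1) * g" by (elim dvdE)
  have b: "b = (q + 1) * g"
  proof -
    have "(p + 1) * b = (p + 1) * ((q + 1) * g)" using rel by (simp add: a algebra_simps)
    then show ?thesis using p by simp
  qed
  have g: "0 < g" using M_pos[OF ab(1)] p unfolding a by (simp add: zero_less_mult_iff)
  have f: "f = g * (p * q - 1)" using p(2) by (simp add: a b algebra_simps)
  obtain u v where uv: "u * (p + 1) + v * (q + 1) = 1"
    using bezout_int[of "p + 1" "q + 1"] cop by (auto simp: coprime_iff_gcd_eq_1)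
  show ?thesis
  proof (rule that[of g])
    have "\<exists>x y. 0 \<le> x \<and> 0 \<le> y \<and> z = x * a + y * b" if z: "z \<in> Z" "g dvd z" for z
    proof -
      from z(2) obtain w where w: "z = g * w" by (elim dvdE)
      \<comment> \<open>The Bezout coefficient of \<open>a\<close> is reduced modulo
        \<open>q + 1\<close>, and the relation \<open>(q + 1) * a = (p + 1) * b\<close> carries the
        excess to \<open>y\<close>. As \<open>x \<le> q\<close>, a negative \<open>y\<close> would
        make \<open>f = q * a - b\<close> an element of \<open>Z\<close>.\<close>
      define x where "x = (w * u) mod (q + 1)"
      define y where "y = w * v + (p + 1) * ((w * u) div (q + 1))"
      have x: "0 \<le> x" "x \<le> q" using q pos_mod_bound[of "q + 1" "w * u"] by (auto simp: x_def)
      have xdiv: "w * u = (q + 1) * ((w * u) div (q + 1)) + x" by (simp add: x_def)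
      have "w = w * (u * (p + 1) + v * (q + 1))" using uv by simp
      also have "\<dots> = (w * u) * (p + 1) + w * v * (q + 1)" by (simp add: algebra_simps)
      also have "\<dots> = ((q + 1) * ((w * u) div (q + 1)) + x) * (p + 1) + w * v * (q + 1)"
        using xdiv by simp
      also have "\<dots> = x * (p + 1) + y * (q + 1)" by (simp add: y_def algebra_simps)
      finally have wxy: "w = x * (p + 1) + y * (q + 1)" .
      then have zxy: "z = x * a + y * b" by (simp add: w a b algebra_simps)
      have "0 \<le> y"
      proof (rule ccontr)
        assume "\<not> 0 \<le> y"
        then have "(q - x) * a + (- 1 - y) * b \<in> Z" using ab x by (intro Z_comb2) auto
        from Z_add[OF z(1) this] have "z + ((q - x) * a + (- 1 - y) * b) \<in> Z" .
        moreover have "z + ((q - x) * a + (- 1 - y) * b) = f" using zxy q(2) by (simp add: algebra_simps)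
        ultimately show False using f_notin by simp
      qed
      then show ?thesis using x zxy by blast
    qed
    then show "\<forall>z\<in>Z. g dvd z \<longrightarrow> (\<exists>x y. 0 \<le> x \<and> 0 \<le> y \<and> z = x * a + y * b)" by blast
  qed (use g a b f in auto)
qed

text \<open>By reflection all large integers lie in \<open>Z\<close>, and \<open>e\<close> divides
  two consecutive ones.\<close>

lemma gcd_generators:
  assumes M: "quadruple a b c d" and e: "e dvd a" "e dvd b" "e dvd c" "e dvd d"
  shows "is_unit e"
proof -
  have dvd: "e dvd x" if "x \<in> Z" for x
    using representation[OF M that] e by (auto intro!: dvd_add dvd_mult)
  have large: "x \<in> Z" if "\<bar>f\<bar> + \<bar>f'\<bar> < x" for x
  proof (rule ccontr)
    assume "x \<notin> Z"
    then have "f + f' - x \<in> Z" using that by (intro reflect) auto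
    then show False using that Z_nonneg by force
  qed
  have "e dvd (\<bar>f\<bar> + \<bar>f'\<bar> + 2) - (\<bar>f\<bar> + \<bar>f'\<bar> + 1)" using dvd large by (intro dvd_diff) auto
  then show ?thesis by simp
qed

text \<open>The edges between \<open>c\<close> and \<open>d\<close> for f are missing for f', so
  \<open>f' + c\<close> and \<open>f' + d\<close> are combinations of \<open>a\<close> and
  \<open>b\<close>, hence divisible by \<open>g\<close>. A common divisor of \<open>g\<close> and
  \<open>c\<close> then divides all generators. The bound holds because \<open>g * c\<close> is
  itself a combination of \<open>a\<close> and \<open>b\<close>.\<close>

lemma two_cycle_third:
  assumes M: "quadruple a b c d" and s: "single f a b" "single f b a"
    and e: "f + c - d \<in> Z" "f + d - c \<in> Z"
  obtains g where "0 < g" "g dvd a" "g dvd f" "g dvd f' + c" "g dvd f' + d" "coprime g c"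
    "\<forall>h i m. single h i c \<longrightarrow> h + i = m * c \<longrightarrow> m < g"
proof -
  note q = quadruple_mem[OF M]
  have M': "quadruple c d a b" by (rule quadruple_rotate[OF quadruple_rotate[OF M]])
  obtain g where g: "0 < g" "g dvd a" "g dvd b" "g dvd f"
    "\<forall>z\<in>Z. g dvd z \<longrightarrow> (\<exists>x y. 0 \<le> x \<and> 0 \<le> y \<and> z = x * a + y * b)"
    by (rule two_cycle_multiples[OF s])
  have cd: "f' + c - d \<notin> Z" "f' + d - c \<notin> Z" using e edge_iff[OF q(3,4,10)] edge_iff[OF q(4,3,16)] by auto
  have cc: "f' + c - c \<notin> Z" "f' + d - d \<notin> Z" using f_notin by simp_all
  obtain x y where "f' + c = x * a + y * b" by (rule representation2[OF M' f_add_M(2)[OF q(3)] cc(1) cd(1)])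
  moreover obtain x y where "f' + d = x * a + y * b" by (rule representation2[OF M' f_add_M(2)[OF q(4)] cd(2) cc(2)])
  ultimately have dvd: "g dvd f' + c" "g dvd f' + d" using g by auto
  have cop: "coprime g c"
  proof (rule coprimeI)
    fix e assume e: "e dvd g" "e dvd c"
    have "e dvd (f' + d) - (f' + c) + c"
      by (intro dvd_add[OF dvd_diff] dvd_trans[OF e(1)] dvd e(2))
    then have "e dvd d" by simp
    then show "is_unit e"
      by (rule gcd_generators[OF M dvd_trans[OF e(1) g(2)] dvd_trans[OF e(1) g(3)] e(2)])
  qed
  have "m < g" if h: "single h i c" "h + i = m * c" for h i m
  proof (rule ccontr)
    assume "\<not> m < g"
    moreover have "g * c \<in> Z" using g q by (intro Z_mult M_Z) auto
    then obtain x y where "0 \<le> x" "0 \<le> y" "g * c = x * a + y * b" using g(5) by (meson dvd_triv_left)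
    ultimately have "g = 0" using single_unique2[OF h _ q(1,6) q(2,8), of g x y] by simp
    then show False using g by simp
  qed
  then show ?thesis using that[of g] g dvd cop by blast
qed

text \<open>Here \<open>g\<close> divides \<open>f + d - c = (m - 1) * c\<close>, hence
  \<open>m - 1\<close>, which is positive as \<open>m\<close> is even. This contradicts
  \<open>m < g\<close>.\<close>

lemma no_two_cycle_odd1:
  assumes M: "quadruple a b c d" and s: "single f a b" "single f b a" "single f d c"
    and e: "f + c - d \<in> Z" and odd: "odd f"
  shows False
proof -
  obtain g where g: "0 < g" "g dvd a" "g dvd f" "g dvd f' + c" "g dvd f' + d" "coprime g c"
    "\<forall>h i m. single h i c \<longrightarrow> h + i = m * c \<longrightarrow> m < g"
    by (rule two_cycle_third[OF M s(1,2) e single_edge[OF s(3)]])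
  obtain m where m: "1 \<le> m" "f + d = m * c" "even m \<longleftrightarrow> odd f" by (rule single_multiple[OF s(3)])
  have "g dvd f + ((f' + d) - (f' + c))" by (rule dvd_add[OF g(3) dvd_diff[OF g(5,4)]])
  moreover have "f + ((f' + d) - (f' + c)) = (m - 1) * c" using m by (simp add: algebra_simps)
  ultimately have "g dvd (m - 1) * c" by simp
  then have "g dvd m - 1" using g(6) by (simp add: coprime_dvd_mult_left_iff)
  moreover have "0 < m - 1" using m odd by (cases "m = 1") auto
  ultimately have "g \<le> m - 1" by (rule zdvd_imp_le)
  then show False using g(7) s(3) m(2) by fastforce
qed

text \<open>Here \<open>g\<close> divides \<open>f' + c + a = (m + 1) * c\<close>, hence
  \<open>m + 1\<close>. As \<open>g\<close> divides the odd number \<open>a\<close> and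
  \<open>m + 1\<close> is even, they differ, so \<open>g \<le> m\<close>, against
  \<open>m < g\<close>.\<close>

lemma no_two_cycle_odd2:
  assumes M: "quadruple a b c d" and s: "single f a b" "single f b a" "single f' a c"
    and e: "f + c - d \<in> Z" "f + d - c \<in> Z" and odd: "odd f"
  shows False
proof -
  interpret r: reflected_semigroup Z M f' f by (rule swap)
  obtain g where g: "0 < g" "g dvd a" "g dvd f" "g dvd f' + c" "g dvd f' + d" "coprime g c"
    "\<forall>h i m. single h i c \<longrightarrow> h + i = m * c \<longrightarrow> m < g"
    by (rule two_cycle_third[OF M s(1,2) e])
  obtain m where m: "1 \<le> m" "f' + a = m * c" "even m \<longleftrightarrow> odd f'" by (rule r.single_multiple[OF s(3)])
  have "g dvd (f' + c) + a" by (rule dvd_add[OF g(4,2)])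
  moreover have "(f' + c) + a = (m + 1) * c" using m by (simp add: algebra_simps)
  ultimately have "g dvd (m + 1) * c" by simp
  then have "g dvd m + 1" using g(6) by (simp add: coprime_dvd_mult_left_iff)
  moreover have "g \<le> m + 1" using calculation m by (intro zdvd_imp_le) auto
  moreover have "odd g" using g(2) M_odd[OF quadruple_mem(1)[OF M]] by (auto elim: dvdE)
  moreover have "even (m + 1)" using m odd odd_sum by auto
  ultimately have "g \<le> m" by (cases "g = m + 1") auto
  then show False using g(7) s(3) m(2) by fastforce
qed

subsection \<open>Cycles of length four\<close>

text \<open>Eliminating f and f' gives a relation between \<open>b\<close>, \<open>c\<close> and
  \<open>d\<close>. The bounds \<open>x \<le> p - 1\<close> and \<open>w \<le> r\<close>, whose
  failure would put \<open>f' - f\<close> or \<open>f' + b - a\<close> into \<open>Z\<close>, bring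
  it within reach of uniqueness for \<open>b\<close> and \<open>d\<close>, so it is trivial.\<close>

lemma four_cycle_coefficients:
  assumes M: "quadruple a b c d"
    and s: "single f a b" "single f b c" "single f c d" "single f d a"
    and m: "f + a = p * b" "f + b = q * c" "f + c = r * d" "f + d = t * a" "1 \<le> r" "1 \<le> t"
    and u: "f' + a = x * b + y * c" "0 \<le> x" "1 \<le> y"
    and v: "f' + b = y' * c + w * d" "0 \<le> y'" "0 \<le> w"
  shows "x = p - 1 \<and> y' = y - 1 \<and> w = r"
proof -
  note qm = quadruple_mem[OF M]
  have "x \<le> p - 1"
  proof (rule ccontr)
    assume "\<not> x \<le> p - 1"
    then have "(x - p) * b + y * c \<in> Z" using u(3) by (intro Z_comb2 qm) auto
    moreover have "(x - p) * b + y * c = f' - f" using u(1) m(1) by (simp add: algebra_simps)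
    ultimately show False using diff_notin by simp
  qed
  moreover have "w \<le> r"
  proof (rule ccontr)
    assume "\<not> w \<le> r"
    then have "(y' + 1) * c + (w - r - 1) * d + (t - 1) * a \<in> Z" using v(2,3) m(5,6) by (intro Z_comb3 qm) auto
    moreover have "(y' + 1) * c + (w - r - 1) * d + (t - 1) * a = f' + b - a"
      using v(1) m(3,4) by (simp add: algebra_simps)
    ultimately show False using single_coedge(1)[OF s(1)] by simp
  qed
  moreover have rel: "(p - 1 - x) * b + (y' - y + 1) * c = (r - w) * d"
    using u(1) v(1) m(1,3) by (simp add: algebra_simps)
  moreover have "y \<le> y' + 1"
  proof (rule ccontr)
    assume "\<not> y \<le> y' + 1"
    moreover have "(p - 1 - x) * b = (y - 1 - y') * c + (r - w) * d" using rel by (simp add: algebra_simps)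
    moreover have "p - 1 - x \<le> p" using u by simp
    ultimately have "y - 1 - y' = 0"
      using single_unique2[OF s(1) m(1) _ qm(3,14) qm(4,15), of "p - 1 - x" "y - 1 - y'" "r - w"] \<open>w \<le> r\<close> by simp
    then show False using \<open>\<not> y \<le> y' + 1\<close> by simp
  qed
  ultimately have "p - 1 - x = 0 \<and> y' - y + 1 = 0 \<and> r - w = 0"
    using v(2,3) by (intro single_unique2[OF s(3) m(3) _ qm(2,9) qm(3,10)]) simp_all
  then show ?thesis by simp
qed

text \<open>Comparing coefficients at \<open>a\<close> and, after rotation, at \<open>b\<close>
  gives \<open>f' + a = (p - 1) * b + q * c\<close>. The right side is
  \<open>(f + a - b) + (f + b)\<close>.\<close>

lemma four_cycle_double:
  assumes M: "quadruple a b c d"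
    and s: "single f a b" "single f b c" "single f c d" "single f d a"
  shows "f' = 2 * f"
proof -
  note qm = quadruple_mem[OF M]
  have M': "quadruple a d b c" "quadruple b a c d" "quadruple c b d a"
    proof -
    show "quadruple a d b c" by (rule quadruple_perm[OF M], blast, use qm in simp)
    show "quadruple b a c d" by (rule quadruple_perm[OF M], blast, use qm in simp)
    show "quadruple c b d a" by (rule quadruple_perm[OF M], blast, use qm in simp)
  qed
  obtain p where p: "1 \<le> p" "f + a = p * b" by (rule single_multiple[OF s(1)])
  obtain q where q: "1 \<le> q" "f + b = q * c" by (rule single_multiple[OF s(2)])
  obtain r where r: "1 \<le> r" "f + c = r * d" by (rule single_multiple[OF s(3)])
  obtain t where t: "1 \<le> t" "f + d = t * a" by (rule single_multiple[OF s(4)])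
  have self: "f' + k - k \<notin> Z" for k using f_notin by simp
  \<comment> \<open>Subtracting \<open>c\<close> first ensures that \<open>f' + a\<close> has the
    positive coefficient \<open>y + 1\<close> at \<open>c\<close>, as the comparison
    requires.\<close>
  have "f' + a - c \<in> Z" by (rule single_coedge(2)[OF s(3) qm(1,6,7)])
  then obtain x y where xy: "0 \<le> x" "0 \<le> y" "f' + a - c = x * b + y * c"
    by (rule representation2[OF M'(1) _ minus_notin_mono[OF self qm(3)]
          minus_notin_mono[OF single_coedge(1)[OF s(4)] qm(3)]])
  obtain y' w where yw: "0 \<le> y'" "0 \<le> w" "f' + b = y' * c + w * d"
    by (rule representation2[OF M'(2) f_add_M(2)[OF qm(2)] self single_coedge(1)[OF s(1)]])
  obtain y'' w' where yw': "0 \<le> y''" "0 \<le> w'" "f' + c = y'' * d + w' * a"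
    by (rule representation2[OF M'(3) f_add_M(2)[OF qm(3)] self single_coedge(1)[OF s(2)]])
  have "x = p - 1 \<and> y' = (y + 1) - 1 \<and> w = r"
    using xy yw r t by (intro four_cycle_coefficients[OF M s p(2) q(2) r(2) t(2)]) (auto simp: algebra_simps)
  moreover have "y' = q - 1 \<and> y'' = w - 1 \<and> w' = t"
    using calculation yw yw' r t p
    by (intro four_cycle_coefficients[OF quadruple_rotate[OF M] s(2-4,1) q(2) r(2) t(2) p(2)]) auto
  ultimately have pq: "x = p - 1" "y = q - 1" by simp_all
  have "f' + a - c = (p * b - b) + (q * c - c)" unfolding xy(3) pq by (simp add: algebra_simps)
  then show ?thesis using p(2) q(2) by simp
qed

text \<open>A representation of \<open>f' + a - c\<close> by \<open>b\<close> and \<open>c\<close>,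
  with its coefficients bounded, turns \<open>f + c = r * d\<close> into a combination of
  \<open>b\<close> and \<open>c\<close>, against uniqueness for \<open>d\<close>.\<close>

lemma no_alternating_cycle1:
  assumes M: "quadruple a b c d" and s: "single f a b" "single f c d" "single f' b c"
    and e: "f + d - a \<in> Z"
  shows False
proof -
  interpret r: reflected_semigroup Z M f' f by (rule swap)
  note qm = quadruple_mem[OF M]
  have M': "quadruple a d b c" by (rule quadruple_perm[OF M], blast, use qm in simp)
  obtain p where p: "1 \<le> p" "f + a = p * b" by (rule single_multiple[OF s(1)])
  obtain r where r: "1 \<le> r" "f + c = r * d" by (rule single_multiple[OF s(2)])
  obtain q where q: "1 \<le> q" "f' + b = q * c" by (rule r.single_multiple[OF s(3)])
  have ad: "f' + a - d \<notin> Z" using edge_iff[OF qm(4,1,13)] e by simp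
  have "f' + a - a \<notin> Z" using f_notin by simp
  note aa = minus_notin_mono[OF this qm(3)]
  have "f' + a - c \<in> Z" by (rule single_coedge(2)[OF s(2) qm(1,6,7)])
  then obtain x y where xy: "0 \<le> x" "0 \<le> y" "f' + a - c = x * b + y * c"
    by (rule representation2[OF M' _ aa minus_notin_mono[OF ad qm(3)]])
  have "y + 1 \<le> q - 1"
  proof (rule ccontr)
    assume "\<not> y + 1 \<le> q - 1"
    then have "x * b + (y + 1 - q) * c \<in> Z" using xy(1,2) by (intro Z_comb2 qm) auto
    moreover have "x * b + (y + 1 - q) * c = a - b" using xy(3) q(2) by (simp add: algebra_simps)
    ultimately show False using M_minimal[OF qm(1,2,5)] by simp
  qed
  moreover have "x \<le> p - 1"
  proof (rule ccontr)
    assume "\<not> x \<le> p - 1"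
    then have "(x - p) * b + (y + 1) * c \<in> Z" using xy(1,2) by (intro Z_comb2 qm) auto
    moreover have "(x - p) * b + (y + 1) * c = f' - f" using xy(3) p(2) by (simp add: algebra_simps)
    ultimately show False using diff_notin by simp
  qed
  moreover have "r * d = (p - 1 - x) * b + (q - y) * c"
    using p(2) q(2) r(2) xy(3) by (simp add: algebra_simps)
  ultimately have "r = 0"
    using single_unique2[OF s(2) r(2) _ qm(2,9) qm(3,10), of r "p - 1 - x" "q - y"] by simp
  then show False using r by simp
qed

text \<open>In every representation of \<open>f' + a\<close> by \<open>c\<close> and
  \<open>d\<close> the coefficient of \<open>c\<close> is the even number \<open>q - 1\<close>.
  Halving \<open>f + f' + a\<close> produces one in which it is odd.\<close>

lemma no_alternating_cycle2:
  assumes M: "quadruple a b c d" and s: "single f a b" "single f c d" "single f' b c" "single f' d a"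
    and e: "f + b - a \<in> Z" "f + b - c \<notin> Z" and odd: "odd f"
  shows False
proof -
  interpret r: reflected_semigroup Z M f' f by (rule swap)
  note qm = quadruple_mem[OF M]
  have M': "quadruple b c a d" by (rule quadruple_perm[OF M], blast, use qm in simp)
  obtain p where p: "1 \<le> p" "f + a = p * b" "even p \<longleftrightarrow> odd f" by (rule single_multiple[OF s(1)])
  obtain r where r: "1 \<le> r" "f + c = r * d" "even r \<longleftrightarrow> odd f" by (rule single_multiple[OF s(2)])
  obtain q where q: "1 \<le> q" "f' + b = q * c" "even q \<longleftrightarrow> odd f'" by (rule r.single_multiple[OF s(3)])
  obtain t where t: "1 \<le> t" "f' + d = t * a" by (rule r.single_multiple[OF s(4)])
  have par: "even p" "odd q" using p q odd odd_sum by auto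
  have ab: "f' + a - b \<notin> Z" using edge_iff[OF qm(2,1,11)] e by simp
  have ac: "f' + a - c \<in> Z" by (rule single_coedge(2)[OF s(2) qm(1,6,7)])
  have ca: "f' + c - a \<in> Z" by (rule single_coedge(2)[OF s(1) qm(3,12,14)])
  have "f + b - b \<notin> Z" using f_notin by simp
  then obtain x y where xy: "0 \<le> x" "0 \<le> y" "f + b - a = x * a + y * d"
    by (rule representation2[OF M' e(1) minus_notin_mono[OF _ qm(1)] minus_notin_mono[OF e(2) qm(1)]])
  have x: "x \<le> t - 1"
  proof (rule ccontr)
    assume "\<not> x \<le> t - 1"
    then have "(x - t) * a + (y + 1) * d \<in> Z" using xy(1,2) by (intro Z_comb2 qm) auto
    from Z_add[OF this ac] have "(x - t) * a + (y + 1) * d + (f' + a - c) \<in> Z" .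
    moreover have "(x - t) * a + (y + 1) * d + (f' + a - c) = f + b - c"
      using xy(3) t(2) by (simp add: algebra_simps)
    ultimately show False using e by simp
  qed
  have y: "y \<le> r - 1"
  proof (rule ccontr)
    assume "\<not> y \<le> r - 1"
    then have "(x + 1) * a + (y - r) * d \<in> Z" using xy(1,2) by (intro Z_comb2 qm) auto
    moreover have "(x + 1) * a + (y - r) * d = b - c" using xy(3) r(2) by (simp add: algebra_simps)
    ultimately show False using M_minimal[OF qm(2,3,8)] by simp
  qed
  \<comment> \<open>The representation is compared with that of \<open>f + b - a\<close> by
    \<open>a\<close> and \<open>d\<close>. Uniqueness for \<open>a\<close> yields
    \<open>r \<le> y + u\<close>, and then uniqueness for \<open>c\<close> fixes
    \<open>v\<close>.\<close>
  have coeff: "v = q - 1" if uv: "f' + a = u * d + v * c" "0 \<le> u" "0 \<le> v" for u v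
  proof -
    have v: "v \<le> q - 1"
    proof (rule ccontr)
      assume "\<not> v \<le> q - 1"
      then have "u * d + (v - q) * c \<in> Z" using uv(2,3) by (intro Z_comb2 qm) auto
      moreover have "u * d + (v - q) * c = a - b" using uv(1) q(2) by (simp add: algebra_simps)
      ultimately show False using M_minimal[OF qm(1,2,5)] by simp
    qed
    have rel: "(q - 1 - v) * c = x * a + (y + u - r) * d"
      using uv(1) xy(3) q(2) r(2) by (simp add: algebra_simps)
    have "r \<le> y + u"
    proof (rule ccontr)
      assume "\<not> r \<le> y + u"
      moreover have "x * a = (q - 1 - v) * c + (r - y - u) * d" using rel by (simp add: algebra_simps)
      ultimately have "r - y - u = 0"
        using single_unique2[OF s(4) t(2) _ qm(3,12) qm(4,13), of x "q - 1 - v" "r - y - u"] x v by simp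
      then show False using \<open>\<not> r \<le> y + u\<close> by simp
    qed
    then show ?thesis
      using single_unique2[OF s(3) q(2) _ qm(1,6) qm(4,16), of "q - 1 - v" x "y + u - r"] rel xy(1) uv(3) by simp
  qed
  obtain h where h: "h \<in> Z" "2 * h = f + f' + a" by (rule half[OF qm(1)])
  have "h - a \<notin> Z"
  proof
    assume "h - a \<in> Z"
    from Z_add[OF h(1) this] have "h + (h - a) \<in> Z" .
    moreover have "h + (h - a) = f + f'" using h(2) by simp
    ultimately show False using f_notin by simp
  qed
  then obtain y2 y3 y4 where ys: "0 \<le> y2" "0 \<le> y3" "0 \<le> y4" "h = y2 * b + y3 * c + y4 * d"
    by (rule representation3[OF M h(1)])
  have sum: "f + f' + a = 2 * y2 * b + 2 * y3 * c + 2 * y4 * d" using h(2) ys(4) by (simp add: algebra_simps)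
  have y2: "2 * y2 < p"
  proof (rule ccontr)
    assume "\<not> 2 * y2 < p"
    then have "(2 * y2 - p) * b + 2 * y3 * c + 2 * y4 * d \<in> Z" using ys(1-3) by (intro Z_comb3 qm) auto
    moreover have "(2 * y2 - p) * b + 2 * y3 * c + 2 * y4 * d = f'" using sum p(2) by (simp add: algebra_simps)
    ultimately show False using f_notin by simp
  qed
  have y3: "2 * y3 \<le> q"
  proof (rule ccontr)
    assume "\<not> 2 * y3 \<le> q"
    then have "(2 * y2 + 1) * b + (2 * y3 - q - 1) * c + 2 * y4 * d \<in> Z" using ys(1-3) by (intro Z_comb3 qm) auto
    from Z_add[OF this ca] have "(2 * y2 + 1) * b + (2 * y3 - q - 1) * c + 2 * y4 * d + (f' + c - a) \<in> Z" .
    moreover have "(2 * y2 + 1) * b + (2 * y3 - q - 1) * c + 2 * y4 * d + (f' + c - a) = f + f'"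
      using sum q(2) by (simp add: algebra_simps)
    ultimately show False using f_notin by simp
  qed
  have rel: "2 * y4 * d = (p - 1 - 2 * y2) * b + (q - 2 * y3) * c"
    using sum p(2) q(2) by (simp add: algebra_simps)
  \<comment> \<open>Since \<open>p\<close> is even, \<open>p - 1 - 2 * y2\<close> is odd and the
    relation nontrivial, so \<open>2 * y4\<close> lies beyond the range of uniqueness. Afterwards
    \<open>r * d\<close> can be traded for \<open>f + c\<close>.\<close>
  have y4: "r < 2 * y4"
  proof (rule ccontr)
    assume "\<not> r < 2 * y4"
    then have "p - 1 - 2 * y2 = 0"
      using single_unique2[OF s(2) r(2) _ qm(2,9) qm(3,10), of "2 * y4" "p - 1 - 2 * y2" "q - 2 * y3"] rel y2 y3 by simp
    then show False using par by presburger
  qed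
  have "y2 = 0"
  proof (rule ccontr)
    assume "y2 \<noteq> 0"
    then have "(2 * y2 - 1) * b + (2 * y3 + 1) * c + (2 * y4 - r) * d \<in> Z"
      using ys(1-3) y4 by (intro Z_comb3 qm) auto
    moreover have "(2 * y2 - 1) * b + (2 * y3 + 1) * c + (2 * y4 - r) * d = f' + a - b"
      using sum r(2) by (simp add: algebra_simps)
    ultimately show False using ab by simp
  qed
  then have "f' + a = (2 * y4 - r) * d + (2 * y3 + 1) * c" using sum r(2) by (simp add: algebra_simps)
  then have "2 * y3 + 1 = q - 1" by (rule coeff) (use ys(2) y4 in simp_all)
  then show False using par by presburger
qed

end

subsection \<open>Existence of a four-cycle\<close>

text \<open>Here E x y means that y divides f + x; by reflection, y divides f' + x if and only if E y x fails.
  So A x y z w and B x y z w say that y is the only divisor of f + x and of f' + x, respectively.\<close>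

lemma four_cycle_in_digraph:
  fixes E :: "'a \<Rightarrow> 'a \<Rightarrow> bool"
  defines "A \<equiv> \<lambda>x y z w. E x y \<and> \<not> E x z \<and> \<not> E x w"
    and "B \<equiv> \<lambda>x y z w. \<not> E y x \<and> E z x \<and> E w x"
  assumes dist: "distinct [a, b, c, d]"
    and H: "\<And>x y z w. {x, y, z, w} = {a, b, c, d} \<Longrightarrow> distinct [x, y, z, w] \<Longrightarrow>
     (E x y \<or> E x z \<or> E x w) \<and> \<not> (E y x \<and> E z x \<and> E w x) \<and>
     \<not> (A x y z w \<and> A z y x w) \<and> \<not> (B x y z w \<and> B z y x w) \<and>
     \<not> (A x y z w \<and> B z y x w) \<and> \<not> (A x y z w \<and> B x y z w) \<and>
     \<not> (A x y z w \<and> B x w y z \<and> A w z x y) \<and> \<not> (B x y z w \<and> A x w y z \<and> B w z x y) \<and>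
     \<not> (B x y z w \<and> B y x z w) \<and> \<not> (A x y z w \<and> A y x z w \<and> A w z x y \<and> E z w) \<and>
     \<not> (A x y z w \<and> A y x z w \<and> B x z y w \<and> E z w \<and> E w z) \<and>
     \<not> (A x y z w \<and> A z w x y \<and> B y z x w \<and> E w x) \<and>
     \<not> (A x y z w \<and> A z w x y \<and> B y z x w \<and> B w x y z \<and> E y x \<and> \<not> E y z) \<and>
     \<not> (B x y z w \<and> B y z x w \<and> B z w x y \<and> B w x y z)"
  shows "\<exists>x y z w. {x, y, z, w} = {a, b, c, d} \<and> distinct [x, y, z, w] \<and>
     A x y z w \<and> A y z x w \<and> A z w x y \<and> A w x y z"
proof (rule ccontr)
  assume no_cycle: "\<not> ?thesis"
  \<comment> \<open>\<open>Q\<close> joins the absence of a four-cycle to the hypotheses. Its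
    instances at the 24 orderings of the vertices form an unsatisfiable propositional problem in the
    twelve possible edges.\<close>
  define Q where "Q x y z w \<longleftrightarrow>
     (E x y \<or> E x z \<or> E x w) \<and> \<not> (E y x \<and> E z x \<and> E w x) \<and>
     \<not> (A x y z w \<and> A z y x w) \<and> \<not> (B x y z w \<and> B z y x w) \<and>
     \<not> (A x y z w \<and> B z y x w) \<and> \<not> (A x y z w \<and> B x y z w) \<and>
     \<not> (A x y z w \<and> B x w y z \<and> A w z x y) \<and> \<not> (B x y z w \<and> A x w y z \<and> B w z x y) \<and>
     \<not> (B x y z w \<and> B y x z w) \<and> \<not> (A x y z w \<and> A y x z w \<and> A w z x y \<and> E z w) \<and>
     \<not> (A x y z w \<and> A y x z w \<and> B x z y w \<and> E z w \<and> E w z) \<and>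
     \<not> (A x y z w \<and> A z w x y \<and> B y z x w \<and> E w x) \<and>
     \<not> (A x y z w \<and> A z w x y \<and> B y z x w \<and> B w x y z \<and> E y x \<and> \<not> E y z) \<and>
     \<not> (B x y z w \<and> B y z x w \<and> B z w x y \<and> B w x y z) \<and>
     \<not> (A x y z w \<and> A y z x w \<and> A z w x y \<and> A w x y z)" for x y z w
  have Q: "Q x y z w" if "{x, y, z, w} = {a, b, c, d}" "distinct [x, y, z, w]" for x y z w
    unfolding Q_def using H[OF that] no_cycle[unfolded not_ex, rule_format, of x y z w] that by argo
  have neq: "a \<noteq> b" "a \<noteq> c" "a \<noteq> d" "b \<noteq> c" "b \<noteq> d" "c \<noteq> d"
    "b \<noteq> a" "c \<noteq> a" "d \<noteq> a" "c \<noteq> b" "d \<noteq> b" "d \<noteq> c"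
    using dist by auto
  have
    "Q a b c d" "Q a b d c" "Q a c b d" "Q a c d b" "Q a d b c" "Q a d c b" "Q b a c d" "Q b a d c"
    "Q b c a d" "Q b c d a" "Q b d a c" "Q b d c a" "Q c a b d" "Q c a d b" "Q c b a d" "Q c b d a"
    "Q c d a b" "Q c d b a" "Q d a b c" "Q d a c b" "Q d b a c" "Q d b c a" "Q d c a b" "Q d c b a"
    by (rule Q, blast, simp add: neq)+
  then show False unfolding Q_def A_def B_def by argo
qed

context reflected_semigroup
begin

lemma single_of_edges:
  assumes M: "quadruple x y z w" and "f + x - y \<in> Z" "f + x - z \<notin> Z" "f + x - w \<notin> Z"
  shows "single f x y"
  using assms f_notin unfolding single_def quadruple_def by auto

lemma single_of_coedges:
  assumes M: "quadruple x y z w" and "f + y - x \<notin> Z" "f + z - x \<in> Z" "f + w - x \<in> Z"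
  shows "single f' x y"
proof -
  note q = quadruple_mem[OF M]
  have "f' + x - z \<notin> Z" "f' + x - w \<notin> Z" "f' + x - x \<notin> Z"
    using assms edge_iff[OF q(3,1,12)] edge_iff[OF q(4,1,13)] f_notin by auto
  then show ?thesis using M unfolding single_def quadruple_def by auto
qed

text \<open>The excluded patterns are the preceding results, applied to f or, after swapping, to f'.
  Two-cycles of f' are excluded because f' is even; a four-cycle of f' would give
  \<open>f = 2 * f'\<close>, which is even.\<close>

lemma exists_four_cycle:
  assumes M: "quadruple a b c d" and odd: "odd f"
  obtains x y z w where "quadruple x y z w"
    "single f x y" "single f y z" "single f z w" "single f w x"
proof -
  interpret r: reflected_semigroup Z M f' f by (rule swap)
  have even: "even f'" using odd odd_sum by simp
  define E where "E x y \<longleftrightarrow> f + x - y \<in> Z" for x y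
  let ?A = "\<lambda>x y z w. E x y \<and> \<not> E x z \<and> \<not> E x w"
  let ?B = "\<lambda>x y z w. \<not> E y x \<and> E z x \<and> E w x"
  have A: "single f x y" if "quadruple x y z w" "?A x y z w" for x y z w
    using single_of_edges that by (auto simp: E_def)
  have B: "single f' x y" if "quadruple x y z w" "?B x y z w" for x y z w
    using single_of_coedges that by (auto simp: E_def)
  have "\<exists>x y z w. {x, y, z, w} = {a, b, c, d} \<and> distinct [x, y, z, w] \<and>
     ?A x y z w \<and> ?A y z x w \<and> ?A z w x y \<and> ?A w x y z"
  proof (rule four_cycle_in_digraph[where E = E])
    show "distinct [a, b, c, d]" using M by (simp add: quadruple_def)
    fix x y z w assume xyzw: "{x, y, z, w} = {a, b, c, d}" "distinct [x, y, z, w]"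
    have q: "quadruple x y z w" by (rule quadruple_perm[OF M xyzw])
    note m = quadruple_mem[OF q]
    have perm: "quadruple i j k l" if "{i, j, k, l} = {x, y, z, w}" "distinct [i, j, k, l]" for i j k l
      by (rule quadruple_perm[OF q that])
    have q1: "quadruple z y x w" "quadruple w z x y" "quadruple x w y z" "quadruple y x z w"
      "quadruple x z y w" "quadruple z w x y" "quadruple y z x w" "quadruple w x y z"
      by (rule perm, blast, use m in simp)+
    note sA = A[OF q] A[OF q1(1)] A[OF q1(2)] A[OF q1(3)] A[OF q1(4)] A[OF q1(6)]
    note sB = B[OF q] B[OF q1(1)] B[OF q1(3)] B[OF q1(2)] B[OF q1(4)] B[OF q1(5)] B[OF q1(7)] B[OF q1(6)] B[OF q1(8)]
    have 1: "E x y \<or> E x z \<or> E x w" using out_edge[OF q] by (simp add: E_def)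
    have 2: "\<not> (E y x \<and> E z x \<and> E w x)"
      using r.out_edge[OF q] edge_iff[OF m(2,1,11)] edge_iff[OF m(3,1,12)] edge_iff[OF m(4,1,13)]
      by (auto simp: E_def)
    have 3: "\<not> (?A x y z w \<and> ?A z y x w)" using single_inj sA(1,2) m(6) by blast
    have 4: "\<not> (?B x y z w \<and> ?B z y x w)" using r.single_inj sB(1,2) m(6) by blast
    have 5: "\<not> (?A x y z w \<and> ?B z y x w)" using single_targets_disjoint sA(1) sB(2) by blast
    have 6: "\<not> (?A x y z w \<and> ?B x y z w)" using single_targets_disjoint sA(1) sB(1) by blast
    have 7: "\<not> (?A x y z w \<and> ?B x w y z \<and> ?A w z x y)"
      using no_vertex_single_in_both[OF q] sA(1,3) sB(3) by blast
    have 8: "\<not> (?B x y z w \<and> ?A x w y z \<and> ?B w z x y)"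
      using r.no_vertex_single_in_both[OF q] sB(1,4) sA(4) by blast
    have 9: "\<not> (?B x y z w \<and> ?B y x z w)"
      using r.no_two_cycle_even even sB(1,5) by blast
    have 10: "\<not> (?A x y z w \<and> ?A y x z w \<and> ?A w z x y \<and> E z w)"
      using no_two_cycle_odd1[OF q] odd sA(1,5,3) unfolding E_def by blast
    have 11: "\<not> (?A x y z w \<and> ?A y x z w \<and> ?B x z y w \<and> E z w \<and> E w z)"
      using no_two_cycle_odd2[OF q] odd sA(1,5) sB(6) unfolding E_def by blast
    have 12: "\<not> (?A x y z w \<and> ?A z w x y \<and> ?B y z x w \<and> E w x)"
      using no_alternating_cycle1[OF q] sA(1,6) sB(7) unfolding E_def by blast
    have 13: "\<not> (?A x y z w \<and> ?A z w x y \<and> ?B y z x w \<and> ?B w x y z \<and> E y x \<and> \<not> E y z)"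
      using no_alternating_cycle2[OF q] odd sA(1,6) sB(7,9) unfolding E_def by blast
    have 14: "\<not> (?B x y z w \<and> ?B y z x w \<and> ?B z w x y \<and> ?B w x y z)"
    proof
      assume "?B x y z w \<and> ?B y z x w \<and> ?B z w x y \<and> ?B w x y z"
      then have "f = 2 * f'" using r.four_cycle_double[OF q] sB(1,7,8,9) by blast
      then show False using odd by simp
    qed
    show "(E x y \<or> E x z \<or> E x w) \<and> \<not> (E y x \<and> E z x \<and> E w x) \<and>
     \<not> (?A x y z w \<and> ?A z y x w) \<and> \<not> (?B x y z w \<and> ?B z y x w) \<and>
     \<not> (?A x y z w \<and> ?B z y x w) \<and> \<not> (?A x y z w \<and> ?B x y z w) \<and>
     \<not> (?A x y z w \<and> ?B x w y z \<and> ?A w z x y) \<and> \<not> (?B x y z w \<and> ?A x w y z \<and> ?B w z x y) \<and>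
     \<not> (?B x y z w \<and> ?B y x z w) \<and> \<not> (?A x y z w \<and> ?A y x z w \<and> ?A w z x y \<and> E z w) \<and>
     \<not> (?A x y z w \<and> ?A y x z w \<and> ?B x z y w \<and> E z w \<and> E w z) \<and>
     \<not> (?A x y z w \<and> ?A z w x y \<and> ?B y z x w \<and> E w x) \<and>
     \<not> (?A x y z w \<and> ?A z w x y \<and> ?B y z x w \<and> ?B w x y z \<and> E y x \<and> \<not> E y z) \<and>
     \<not> (?B x y z w \<and> ?B y z x w \<and> ?B z w x y \<and> ?B w x y z)"
      by (intro conjI 1 2 3 4 5 6 7 8 9 10 11 12 13 14)
  qed
  then obtain x y z w where xyzw: "{x, y, z, w} = {a, b, c, d}" "distinct [x, y, z, w]"
    and cyc: "?A x y z w" "?A y z x w" "?A z w x y" "?A w x y z"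
    by blast
  have q: "quadruple x y z w" by (rule quadruple_perm[OF M xyzw])
  note m = quadruple_mem[OF q]
  have q1: "quadruple y z x w" "quadruple z w x y" "quadruple w x y z"
    by (rule quadruple_perm[OF q], blast, use m in simp)+
  show ?thesis
    by (rule that[OF q A[OF q cyc(1)] A[OF q1(1) cyc(2)] A[OF q1(2) cyc(3)] A[OF q1(3) cyc(4)]])
qed

text \<open>Among three coefficients one sign occurs at most once. So the relation writes a multiple
  of one generator, within its range of uniqueness, by the other two.\<close>

lemma small_relation:
  assumes M: "quadruple a b c d" and s: "single f a b" "single f b c" "single f c d"
    and m: "f + a = p * b" "f + b = q * c" "f + c = r * d"
    and bound: "\<bar>i\<bar> \<le> p" "\<bar>j\<bar> \<le> q" "\<bar>k\<bar> \<le> r" and rel: "i * b + j * c + k * d = 0"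
  shows "i = 0 \<and> j = 0 \<and> k = 0"
proof -
  note u1 = single_unique2[OF s(1) m(1) _ quadruple_mem(3,14)[OF M] quadruple_mem(4,15)[OF M]]
  note u2 = single_unique2[OF s(2) m(2) _ quadruple_mem(2,8)[OF M] quadruple_mem(4,16)[OF M]]
  note u3 = single_unique2[OF s(3) m(3) _ quadruple_mem(2,9)[OF M] quadruple_mem(3,10)[OF M]]
  consider "0 \<le> j" "0 \<le> k" | "j \<le> 0" "k \<le> 0" | "0 \<le> i" "0 \<le> j" "k \<le> 0" | "i \<le> 0" "0 \<le> j" "k \<le> 0"
    | "0 \<le> i" "j \<le> 0" "0 \<le> k" | "i \<le> 0" "j \<le> 0" "0 \<le> k" by linarith
  then show ?thesis
  proof cases
    case 1
    then show ?thesis using u1[of "- i" j k] bound rel by simp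
  next
    case 2
    then show ?thesis using u1[of i "- j" "- k"] bound rel by simp
  next
    case 3
    then show ?thesis using u3[of "- k" i j] bound rel by simp
  next
    case 4
    then show ?thesis using u2[of j "- i" "- k"] bound rel by simp
  next
    case 5
    then show ?thesis using u2[of "- j" i k] bound rel by simp
  next
    case 6
    then show ?thesis using u3[of k "- i" "- j"] bound rel by simp
  qed
qed

end

text \<open>Multiplying n1 by b1, b4, b3, b2 in turn runs once around the cycle and returns to n1.
  With its rotations this makes the generators proportional to the explicit formulas, so only f
  remains to be found.\<close>

lemma (in cyclic_relations) scaled_generator:
  "(b1 * b2 * b3 * b4 - 1) * n1 = f * (b2 * b3 * (b4 + 1) + b2 + 1)"
proof -
  have "b1 * b2 * b3 * b4 * n1 = b2 * b3 * b4 * (f + n4)" by (simp only: f_n(4) mult_ac)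
  also have "\<dots> = b2 * b3 * b4 * f + b2 * b3 * (f + n3)" by (simp only: f_n(3) distrib_left mult_ac)
  also have "\<dots> = b2 * b3 * b4 * f + b2 * b3 * f + b2 * (f + n2)" by (simp only: f_n(2) distrib_left mult_ac add.assoc)
  also have "\<dots> = b2 * b3 * b4 * f + b2 * b3 * f + b2 * f + (f + n1)" by (simp only: f_n(1) distrib_left mult_ac add.assoc)
  finally show ?thesis by (simp add: algebra_simps)
qed

section \<open>The generators determined by a four-cycle\<close>

locale four_cycle = reflected_semigroup + cyclic_relations b1 b2 b3 b4 n1 n2 n3 n4 f
  for b1 b2 b3 b4 n1 n2 n3 n4 +
  assumes quad: "quadruple n1 n2 n3 n4"
    and cycle: "single f n1 n2" "single f n2 n3" "single f n3 n4" "single f n4 n1"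
begin

text \<open>Adding generators completes every normal form to one of the corners. As
  \<open>f' = 2 * f\<close>, the corner values minus n1 are f, f' and \<open>f + f'\<close>, none of
  which lies in \<open>Z\<close>.\<close>

lemma val_minus_notin:
  assumes "w \<in> W"
  shows "val w - n1 \<notin> Z"
proof
  note q = quadruple_mem[OF quad]
  assume v: "val w - n1 \<in> Z"
  have f': "f' = 2 * f" by (rule four_cycle_double[OF quad cycle])
  obtain x y z where w: "w = (x, y, z)" by (cases w)
  have nn: "0 \<le> x" "0 \<le> y" "0 \<le> z"
    and "x = b2 \<and> y = 0 \<and> z = 0 \<or> x < b2 \<and> y < b3 \<and> z \<le> b4 \<or> x < b2 \<and> y = b3 \<and> z = 0"
    using assms by (auto simp: w normal_forms_def)
  then consider "x = b2" "y = 0" "z = 0" | "x < b2" "y < b3" "z \<le> b4" | "x < b2" "y = b3" "z = 0" by blast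
  then show False
  proof cases
    case 1
    then have "val w - n1 = f" using f_n(1) by (simp add: w)
    then show False using v f_notin by simp
  next
    case 2
    then have "(b2 - 1 - x) * n2 + (b3 - 1 - y) * n3 + (b4 - z) * n4 \<in> Z" by (intro Z_comb3 q) simp_all
    from Z_add[OF v this]
    have "val w - n1 + ((b2 - 1 - x) * n2 + (b3 - 1 - y) * n3 + (b4 - z) * n4) \<in> Z" .
    moreover have "val w - n1 + ((b2 - 1 - x) * n2 + (b3 - 1 - y) * n3 + (b4 - z) * n4) = f + f'"
      using f_n(1-3) by (simp add: w f' algebra_simps)
    ultimately show False using f_notin by simp
  next
    case 3
    then have "(b2 - 1 - x) * n2 \<in> Z" by (intro Z_mult M_Z q) simp
    from Z_add[OF v this] have "val w - n1 + (b2 - 1 - x) * n2 \<in> Z" .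
    moreover have "val w - n1 + (b2 - 1 - x) * n2 = f'"
      using f_n(1,2) by (simp add: w f' 3 algebra_simps)
    ultimately show False using f_notin by simp
  qed
qed

text \<open>Congruent values differ by \<open>k * n1\<close>, and a nonzero \<open>k\<close> would
  put one of them minus n1 into \<open>Z\<close>. So they are equal, and the differences of the
  coordinates are small enough for \<open>small_relation\<close>.\<close>

lemma val_mod_inj: "inj_on (\<lambda>w. val w mod n1) W"
proof (rule inj_onI)
  have ge: "k \<le> 0" if "w \<in> W" "w' \<in> W" "val w = val w' + k * n1" for w w' k
  proof (rule ccontr)
    assume "\<not> k \<le> 0"
    obtain x y z where w': "w' = (x, y, z)" by (cases w')
    have "x * n2 + y * n3 + z * n4 \<in> Z"
      using that(2) by (intro Z_comb3 quadruple_mem[OF quad]) (auto simp: w' normal_forms_def)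
    moreover have "(k - 1) * n1 \<in> Z"
      using \<open>\<not> k \<le> 0\<close> by (intro Z_mult M_Z quadruple_mem[OF quad]) simp
    ultimately have "x * n2 + y * n3 + z * n4 + (k - 1) * n1 \<in> Z" by (rule Z_add)
    then have "val w - n1 \<in> Z" using that(3) by (simp add: w' algebra_simps)
    then show False using val_minus_notin that(1) by simp
  qed
  fix w w' assume w: "w \<in> W" "w' \<in> W" "val w mod n1 = val w' mod n1"
  then obtain k where k: "val w - val w' = n1 * k" by (auto simp: mod_eq_dvd_iff elim: dvdE)
  have "k \<le> 0" by (rule ge[OF w(1,2)]) (use k in \<open>simp add: algebra_simps\<close>)
  moreover have "- k \<le> 0" by (rule ge[OF w(2,1)]) (use k in \<open>simp add: algebra_simps\<close>)
  ultimately have "k = 0" by simp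
  then have eq: "val w = val w'" using k by simp
  obtain x y z where xyz: "w = (x, y, z)" by (cases w)
  obtain x' y' z' where xyz': "w' = (x', y', z')" by (cases w')
  have "x - x' = 0 \<and> y - y' = 0 \<and> z - z' = 0"
  proof (rule small_relation[OF quad cycle(1-3) f_n(1-3)])
    show "\<bar>x - x'\<bar> \<le> b2" "\<bar>y - y'\<bar> \<le> b3" "\<bar>z - z'\<bar> \<le> b4"
      using w(1,2) b_ge unfolding xyz xyz' normal_forms_def mem_Collect_eq prod.case by linarith+
    show "(x - x') * n2 + (y - y') * n3 + (z - z') * n4 = 0"
      using eq by (simp add: xyz xyz' algebra_simps)
  qed
  then show "w = w'" by (simp add: xyz xyz')
qed

text \<open>With \<open>D = b1 * b2 * b3 * b4 - 1\<close>, the products \<open>D * ni\<close> are f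
  times the explicit formulas. Counting normal forms modulo n1 bounds the formula by n1, whence
  \<open>D \<le> f\<close>. Conversely \<open>f0 = f / gcd f D\<close> divides every generator, so
  it is a unit and f divides \<open>D\<close>.\<close>

lemma f_eq: "f = b1 * b2 * b3 * b4 - 1"
proof -
  define D where "D = b1 * b2 * b3 * b4 - 1"
  note q = quadruple_mem[OF quad]
  interpret r2: cyclic_relations b2 b3 b4 b1 n2 n3 n4 n1 f by (rule rotate)
  interpret r3: cyclic_relations b3 b4 b1 b2 n3 n4 n1 n2 f by (rule r2.rotate)
  interpret r4: cyclic_relations b4 b1 b2 b3 n4 n1 n2 n3 f by (rule r3.rotate)
  have D: "D * n1 = f * (b2 * b3 * (b4 + 1) + b2 + 1)" "D * n2 = f * (b3 * b4 * (b1 + 1) + b3 + 1)"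
    "D * n3 = f * (b4 * b1 * (b2 + 1) + b4 + 1)" "D * n4 = f * (b1 * b2 * (b3 + 1) + b1 + 1)"
    using scaled_generator r2.scaled_generator r3.scaled_generator r4.scaled_generator
    by (simp_all add: D_def mult.commute mult.left_commute)
  have "card W = card ((\<lambda>w. val w mod n1) ` W)" by (rule card_image[OF val_mod_inj, symmetric])
  also have "\<dots> \<le> card {0..<n1}" using n_pos by (intro card_mono) auto
  finally have "b2 * b3 * (b4 + 1) + b2 + 1 \<le> n1"
    using card_normal_forms[of b2 b3 b4] b_ge n_pos by simp
  then have "f * (b2 * b3 * (b4 + 1) + b2 + 1) \<le> f * n1" using f_pos by (intro mult_left_mono) auto
  then have "D * n1 \<le> f * n1" using D(1) by linarith
  then have "D \<le> f" using n_pos by simp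
  moreover have "f \<le> D"
  proof (rule zdvd_imp_le)
    have "f \<noteq> 0" using f_pos by simp
    then have "gcd f D \<noteq> 0" by simp
    then obtain f0 D0 where 0: "f = f0 * gcd f D" "D = D0 * gcd f D" "coprime f0 D0"
      using gcd_coprime_exists by blast
    have dvd: "f0 dvd n" if "D * n = f * k" for n k
    proof -
      have "gcd f D * (D0 * n) = gcd f D * (f0 * k)"
        using that 0(1,2) by (metis mult.assoc mult.commute)
      then have "D0 * n = f0 * k" using \<open>gcd f D \<noteq> 0\<close> mult_left_cancel by blast
      then have "f0 dvd D0 * n" by simp
      then show ?thesis using 0(3) by (simp add: coprime_dvd_mult_right_iff)
    qed
    have "is_unit f0"
      using gcd_generators[OF quad] dvd[OF D(1)] dvd[OF D(2)] dvd[OF D(3)] dvd[OF D(4)] by blast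
    then have "f dvd gcd f D" using 0(1) by (metis dvd_refl mult_unit_dvd_iff')
    then show "f dvd D" using dvd_trans by (metis gcd_dvd2)
    have "2 * 2 \<le> b1 * b2" "2 * 2 \<le> b3 * b4" using b_ge by (intro mult_mono; simp)+
    then have "4 * 4 \<le> (b1 * b2) * (b3 * b4)" by (intro mult_mono) auto
    then show "0 < D" by (simp add: D_def mult.assoc)
  qed
  ultimately show ?thesis by (simp add: D_def)
qed

lemma n_eq:
  "n1 = b2 * b3 * (b4 + 1) + b2 + 1" "n2 = b3 * b4 * (b1 + 1) + b3 + 1"
  "n3 = b4 * b1 * (b2 + 1) + b4 + 1" "n4 = b1 * b2 * (b3 + 1) + b1 + 1"
proof -
  interpret r2: cyclic_relations b2 b3 b4 b1 n2 n3 n4 n1 f by (rule rotate)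
  interpret r3: cyclic_relations b3 b4 b1 b2 n3 n4 n1 n2 f by (rule r2.rotate)
  interpret r4: cyclic_relations b4 b1 b2 b3 n4 n1 n2 n3 f by (rule r3.rotate)
  have D: "f * n1 = f * (b2 * b3 * (b4 + 1) + b2 + 1)" "f * n2 = f * (b3 * b4 * (b1 + 1) + b3 + 1)"
    "f * n3 = f * (b4 * b1 * (b2 + 1) + b4 + 1)" "f * n4 = f * (b1 * b2 * (b3 + 1) + b1 + 1)"
    using scaled_generator r2.scaled_generator r3.scaled_generator r4.scaled_generator f_eq
    by (simp_all add: mult.commute mult.left_commute)
  then show "n1 = b2 * b3 * (b4 + 1) + b2 + 1" "n2 = b3 * b4 * (b1 + 1) + b3 + 1"
    "n3 = b4 * b1 * (b2 + 1) + b4 + 1" "n4 = b1 * b2 * (b3 + 1) + b1 + 1"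
    using f_pos by (simp_all only: mult_cancel_left) simp_all
qed

end

section \<open>The classification\<close>

text \<open>If S contains all natural numbers, 1 is its only possible minimal generator.\<close>

lemma gaps_nonempty:
  assumes "embedding_dim S \<noteq> 0" "embedding_dim S \<noteq> 1"
  shows "gaps S \<noteq> {}"
proof
  assume "gaps S = {}"
  then have S: "S = UNIV" by (auto simp: gaps_def)
  have "x = 1" if "x \<in> minimal_generators S" for x
  proof (rule ccontr)
    assume "x \<noteq> 1"
    moreover have "x \<noteq> 0" using that by (simp add: minimal_generators_def)
    ultimately have "x = 1 + (x - 1)" "x - 1 \<noteq> 0" by simp_all
    then show False using that unfolding minimal_generators_def S by blast
  qed
  then have "minimal_generators S \<subseteq> {1}" by blast
  then have "embedding_dim S \<le> card {1 :: nat}" unfolding embedding_dim_def by (intro card_mono) auto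
  then show False using assms by simp
qed

theorem almost_symmetric_type_three_is_explicit:
  assumes S: "numerical_semigroup S" and dim: "embedding_dim S = 4" and type: "sg_type S = 3"
    and almost: "almost_symmetric S" and odd: "\<forall>x\<in>minimal_generators S. odd x"
  shows "\<exists>a1 a2 a3 a4 :: nat. odd a1 \<and> odd a2 \<and> odd a3 \<and> odd a4 \<and>
           a1 > 1 \<and> a2 > 1 \<and> a3 > 1 \<and> a4 > 1 \<and> S = gen_semigroup (gens4 a1 a2 a3 a4)"
proof -
  define G where "G = minimal_generators S"
  have ne: "gaps S \<noteq> {}" using dim by (intro gaps_nonempty) auto
  obtain f f' where f: "odd f" "even f'" "f + f' = frobenius S"
    "f \<in> pseudo_frobenius S" "f' \<in> pseudo_frobenius S"
    "\<And>x. x \<notin> int ` S \<Longrightarrow> x \<noteq> f \<Longrightarrow> x \<noteq> f' \<Longrightarrow> f + f' - x \<in> int ` S"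
    using type_three_pseudo_frobenius[OF S ne type almost] by blast
  have S0: "0 \<in> S" using S by (simp add: numerical_semigroup_def)
  have GS: "m \<in> S" "m \<noteq> 0" "odd m" if "m \<in> G" for m
    using that odd by (auto simp: G_def minimal_generators_def)
  interpret reflected_semigroup "int ` S" "int ` G" f f'
  proof unfold_locales
    show "0 \<in> int ` S" using S0 by (intro image_eqI[of _ _ 0]) auto
    show "x + y \<in> int ` S" if "x \<in> int ` S" "y \<in> int ` S" for x y
      using int_image_add[OF S ne] that .
    show "0 \<le> x" if "x \<in> int ` S" for x using that by auto
    show "m \<in> int ` S" "0 < m" "odd m" if "m \<in> int ` G" for m
      using that GS by auto
    show "\<exists>m\<in>int ` G. x - m \<in> int ` S" if x: "x \<in> int ` S" "x \<noteq> 0" for x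
    proof -
      obtain n where n: "x = int n" "n \<in> S" "n \<noteq> 0" using x by auto
      then obtain m y where "m \<in> G" "y \<in> S" "n = m + y"
        using minimal_generator_split[OF S] unfolding G_def by blast
      then show ?thesis using n by (intro bexI[of _ "int m"]) auto
    qed
    show "m - k \<notin> int ` S" if mk: "m \<in> int ` G" "k \<in> int ` G" "m \<noteq> k" for m k
    proof
      assume "m - k \<in> int ` S"
      then obtain y where y: "y \<in> S" "m - k = int y" by auto
      obtain m' k' where m': "m = int m'" "m' \<in> G" "k = int k'" "k' \<in> G" using mk by auto
      have "m' = k' + y" "y \<noteq> 0" using y m' mk by auto
      then show False using m' y GS[of k'] unfolding G_def minimal_generators_def by blast
    qed
    show "f \<notin> int ` S" "f' \<notin> int ` S" using f(4,5) by (auto simp: pseudo_frobenius_def)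
    show "f + f' \<notin> int ` S" using frobenius_notin[OF S ne] f(3) by simp
    show "f + z \<in> int ` S" "f' + z \<in> int ` S" if "z \<in> int ` S" "z \<noteq> 0" for z
      using f(4,5) that unfolding pseudo_frobenius_alt[OF S ne] by blast+
    show "f + f' - x \<in> int ` S" if "x \<notin> int ` S" "x \<noteq> f" "x \<noteq> f'" for x
      using f(6) that .
    show "odd (f + f')" using f(1,2) by simp
  qed
  have "card (int ` G) = 4"
    using dim by (simp add: embedding_dim_def G_def card_image)
  then obtain a b c d where "quadruple a b c d"
    unfolding quadruple_def by (auto simp: card_Suc_eq numeral_eq_Suc)
  then obtain n1 n2 n3 n4 where quad: "quadruple n1 n2 n3 n4"
    and cyc: "single f n1 n2" "single f n2 n3" "single f n3 n4" "single f n4 n1"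
    using f(1) by (rule exists_four_cycle)
  note q = quadruple_mem[OF quad]
  obtain b2 where b2: "1 \<le> b2" "f + n1 = b2 * n2" "even b2 \<longleftrightarrow> odd f" by (rule single_multiple[OF cyc(1)])
  obtain b3 where b3: "1 \<le> b3" "f + n2 = b3 * n3" "even b3 \<longleftrightarrow> odd f" by (rule single_multiple[OF cyc(2)])
  obtain b4 where b4: "1 \<le> b4" "f + n3 = b4 * n4" "even b4 \<longleftrightarrow> odd f" by (rule single_multiple[OF cyc(3)])
  obtain b1 where b1: "1 \<le> b1" "f + n4 = b1 * n1" "even b1 \<longleftrightarrow> odd f" by (rule single_multiple[OF cyc(4)])
  \<comment> \<open>As f is odd, all multipliers are even; hence each \<open>bi\<close> is at least
    2, and \<open>bi + 1\<close> is an odd number above 1.\<close>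
  have even: "even b1" "even b2" "even b3" "even b4" using b1 b2 b3 b4 f(1) by auto
  then have "b1 \<noteq> 1" "b2 \<noteq> 1" "b3 \<noteq> 1" "b4 \<noteq> 1" by auto
  then have ge: "2 \<le> b1" "2 \<le> b2" "2 \<le> b3" "2 \<le> b4" using b1(1) b2(1) b3(1) b4(1) by linarith+
  \<comment> \<open>The four-cycle gives \<open>f + f' = 3 * f\<close>, so f is nonnegative, and
    positive because it is odd.\<close>
  have "0 \<le> f + f'" using frobenius_nonneg[OF S ne] f(3) by simp
  then have "0 \<le> f" using four_cycle_double[OF quad cyc] by simp
  then have fpos: "0 < f" using f(1) by (cases "f = 0") auto
  interpret four_cycle "int ` S" "int ` G" f f' b1 b2 b3 b4 n1 n2 n3 n4
    by unfold_locales (use ge fpos b1(2) b2(2) b3(2) b4(2) M_pos q(1-4) quad cyc in auto)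
  define a1 a2 a3 a4 where "a1 = nat (b1 + 1)" "a2 = nat (b2 + 1)" "a3 = nat (b3 + 1)" "a4 = nat (b4 + 1)"
  have a: "int a1 = b1 + 1" "int a2 = b2 + 1" "int a3 = b3 + 1" "int a4 = b4 + 1"
    using ge by (simp_all add: a1_a2_a3_a4_def)
  then have gt: "1 < a1" "1 < a2" "1 < a3" "1 < a4" using ge by linarith+
  then have minus: "int (a1 - 1) = b1" "int (a2 - 1) = b2" "int (a3 - 1) = b3" "int (a4 - 1) = b4"
    using a by (simp_all add: of_nat_diff)
  have "odd (int a1)" "odd (int a2)" "odd (int a3)" "odd (int a4)" unfolding a using even by simp_all
  then have odds: "odd a1" "odd a2" "odd a3" "odd a4" by simp_all
  have "int ` gens4 a1 a2 a3 a4 = {n1, n2, n3, n4}"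
    unfolding gens4_def n_eq by (simp add: minus[unfolded One_nat_def] a add.assoc)
  also have "\<dots> = int ` G" using quad by (simp add: quadruple_def)
  finally have "gens4 a1 a2 a3 a4 = G" by (simp add: inj_image_eq_iff)
  then have "S = gen_semigroup (gens4 a1 a2 a3 a4)"
    using gen_semigroup_minimal_generators[OF S] by (simp add: G_def)
  then show ?thesis using odds gt by blast
qed

theorem theorem5p7:
  shows "(\<forall>a1 a2 a3 a4 :: nat.
            odd a1 \<and> odd a2 \<and> odd a3 \<and> odd a4 \<and>
            a1 > 1 \<and> a2 > 1 \<and> a3 > 1 \<and> a4 > 1 \<and>
            Gcd (gens4 a1 a2 a3 a4) = 1 \<longrightarrow>
              (let S = gen_semigroup (gens4 a1 a2 a3 a4) in
                 numerical_semigroup S \<and> embedding_dim S = 4 \<and>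
                 (\<forall>x\<in>gens4 a1 a2 a3 a4. odd x) \<and>
                 almost_symmetric S \<and> sg_type S = 3))
       \<and>
         (\<forall>S. numerical_semigroup S \<and> embedding_dim S = 4 \<and> sg_type S = 3 \<and>
              almost_symmetric S \<and> (\<forall>x\<in>minimal_generators S. odd x) \<longrightarrow>
              (\<exists>a1 a2 a3 a4 :: nat.
                 odd a1 \<and> odd a2 \<and> odd a3 \<and> odd a4 \<and>
                 a1 > 1 \<and> a2 > 1 \<and> a3 > 1 \<and> a4 > 1 \<and>
                 S = gen_semigroup (gens4 a1 a2 a3 a4)))"
proof (intro conjI allI impI)
  fix a1 a2 a3 a4 :: nat
  assume a: "odd a1 \<and> odd a2 \<and> odd a3 \<and> odd a4 \<and>
    a1 > 1 \<and> a2 > 1 \<and> a3 > 1 \<and> a4 > 1 \<and> Gcd (gens4 a1 a2 a3 a4) = 1"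
  then show "let S = gen_semigroup (gens4 a1 a2 a3 a4) in
     numerical_semigroup S \<and> embedding_dim S = 4 \<and> (\<forall>x\<in>gens4 a1 a2 a3 a4. odd x) \<and>
     almost_symmetric S \<and> sg_type S = 3"
    unfolding Let_def using explicit_family_almost_symmetric[of a1 a2 a3 a4] odd_gens4 by blast
next
  fix S :: "nat set"
  assume "numerical_semigroup S \<and> embedding_dim S = 4 \<and> sg_type S = 3 \<and>
    almost_symmetric S \<and> (\<forall>x\<in>minimal_generators S. odd x)"
  then show "\<exists>a1 a2 a3 a4 :: nat. odd a1 \<and> odd a2 \<and> odd a3 \<and> odd a4 \<and>
     a1 > 1 \<and> a2 > 1 \<and> a3 > 1 \<and> a4 > 1 \<and> S = gen_semigroup (gens4 a1 a2 a3 a4)"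
    by (intro almost_symmetric_type_three_is_explicit) auto
qed

end
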